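(* Let $U=(U_0,U_1^{\top})^{\top}$ be a $(d+1)$-dimensional random variable, with $U_0$ of dimension $1$ and $U_1$ of dimension $d$, having elliptical density $\mathcal{E}_{d+1}(0,\Omega_+,\tilde f)$, where $$\Omega_+=\begin{pmatrix}1&\delta^{\top}\\ \delta&\Omega\end{pmatrix}$$ is positive definite with all diagonal elements equal to $1$, and let $Z=(U_1\mid U_0>0)$. Assume that $U$ is c-unimodal. If $\tilde f$ is $s$-concave, with $s\ge -1$, then $U$ has $s$-concave density, whereas the elliptical density of $U_1$ and the skew-elliptical density of $Z$ are $s_1$-concave, with $s_1=s/(1+s)$. Moreover all conclusions hold strictly if $U$ is unimodal or $\tilde f$ is strictly $s$-concave or the support of $\tilde f$ is bounded.
   Context: A $d$-dimensional random variable has an elliptical density with density generator $\tilde f$, written $\mathcal{E}_d(0,\Omega,\tilde f)$, if its density is $y\mapsto k\,\tilde f(y^{\top}\Omega^{-1}y)$, where $\Omega$ is a $d\times d$ positive definite matrix, $\tilde f:(0,+\infty)\to\mathbb{R}^+$ (non-negative values) is such that $x^{d/2-1}\tilde f(x)$ has finite integral on $(0,+\infty)$, and $k$ is a normalizing constant. The skew-elliptical variable $Z=(U_1\mid U_0>0)$ has the conditional distribution of $U_1$ given $U_0>0$; its density is $f_Z(u_1)=2\int_0^{+\infty}k_1\tilde f(u^{\top}\Omega_+^{-1}u)\,du_0$ with $u^{\top}=(u_0,u_1^{\top})$ and $k_1$ the normalizing constant of the density of $U$. A mode of a density is a point where it takes a maximum value, locally or globally. A density (or a random variable having it) is c-unimodal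 if the set of its modes is convex, and unimodal if its mode is unique; an elliptical density is c-unimodal if and only if its generator $\tilde f$ is non-increasing, and unimodal if and only if $\tilde f$ is decreasing. For real $s\ne0$, a function $f$ on a convex set $S$ is $s$-concave if $f(\theta x+(1-\theta)y)\ge\{\theta f(x)^s+(1-\theta)f(y)^s\}^{1/s}$ for all $x,y\in S$ and $\theta\in(0,1)$; $0$-concave means log-concave, i.e. $f(\theta x+(1-\theta)y)\ge f(x)^{\theta}f(y)^{1-\theta}$; $(-\infty)$-concave means quasi-concave, i.e. $f(\theta x+(1-\theta)y)\ge\min\{f(x),f(y)\}$. The strict versions require strict inequality for all $x\ne y$ and all $\theta$. Concavity properties of a density are understood on its support. By convention, $s_1=-\infty$ when $s=-1$.
   Formalization: Bounded support of f~ gives strictness only for U_1 and Z, not U (false for f~ = 1 on (0,1): U is uniform on an ellipsoid); c-unimodal is taken to require at least one mode (else f~(x) = x on (0,1), zero beyond, is a counterexample). *)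

theory Defs
  imports "HOL-Probability.Probability"
begin

subsection \<open>Power means and s-concavity\<close>

text \<open>Densities take values in \<^typ>\<open>ennreal\<close>, because a generator may have a pole at 0; the
  density is then infinite at the origin, and so may be its marginals.\<close>

definition ennreal_powr :: "ennreal \<Rightarrow> real \<Rightarrow> ennreal" where
  "ennreal_powr a p =
     (if p = 0 then 1
      else if a = 0 then (if p < 0 then \<top> else 0)
      else if a = \<top> then (if p < 0 then 0 else \<top>)
      else ennreal (enn2real a powr p))"

definition power_mean :: "ereal \<Rightarrow> real \<Rightarrow> ennreal \<Rightarrow> ennreal \<Rightarrow> ennreal" where
  "power_mean s \<theta> a b =
     (case s of
        ereal r \<Rightarrow>
          if r = 0 then ennreal_powr a \<theta> * ennreal_powr b (1 - \<theta>)
          else ennreal_powr (ennreal \<theta> * ennreal_powr a r + ennreal (1 - \<theta>) * ennreal_powr b r) (1 / r)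
      | MInfty \<Rightarrow> min a b
      | PInfty \<Rightarrow> max a b)"

definition s_concave_on :: "'a::real_vector set \<Rightarrow> ereal \<Rightarrow> ('a \<Rightarrow> ennreal) \<Rightarrow> bool" where
  "s_concave_on S s g \<longleftrightarrow>
     convex S \<and>
     (\<forall>x\<in>S. \<forall>y\<in>S. \<forall>\<theta>\<in>{0<..<1}.
        g (\<theta> *\<^sub>R x + (1 - \<theta>) *\<^sub>R y) \<ge> power_mean s \<theta> (g x) (g y))"

definition strictly_s_concave_on :: "'a::real_vector set \<Rightarrow> ereal \<Rightarrow> ('a \<Rightarrow> ennreal) \<Rightarrow> bool" where
  "strictly_s_concave_on S s g \<longleftrightarrow>
     convex S \<and>
     (\<forall>x\<in>S. \<forall>y\<in>S. \<forall>\<theta>\<in>{0<..<1}. x \<noteq> y \<longrightarrow>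
        g (\<theta> *\<^sub>R x + (1 - \<theta>) *\<^sub>R y) > power_mean s \<theta> (g x) (g y))"

definition s_concave_density :: "ereal \<Rightarrow> ('a::real_vector \<Rightarrow> ennreal) \<Rightarrow> bool" where
  "s_concave_density s g \<longleftrightarrow> s_concave_on {x. g x > 0} s g"

definition strictly_s_concave_density :: "ereal \<Rightarrow> ('a::real_vector \<Rightarrow> ennreal) \<Rightarrow> bool" where
  "strictly_s_concave_density s g \<longleftrightarrow> strictly_s_concave_on {x. g x > 0} s g"


subsection \<open>Modes\<close>

text \<open>Global maxima are in particular local ones. Points where the density vanishes are not modes:
  otherwise every exterior point of the support would be one.\<close>

definition modes :: "('a::topological_space \<Rightarrow> ennreal) \<Rightarrow> 'a set" where
  "modes g = {m. g m > 0 \<and> (\<forall>\<^sub>F x in nhds m. g x \<le> g m)}"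

text \<open>A density without any mode is not c-unimodal. Without this requirement a density that increases
  towards the boundary of an open support, such as the one with generator equal to x for
  x < 1 and to 0 otherwise, would be c-unimodal although its generator is not
  non-increasing.\<close>

definition c_unimodal :: "('a::real_normed_vector \<Rightarrow> ennreal) \<Rightarrow> bool" where
  "c_unimodal g \<longleftrightarrow> modes g \<noteq> {} \<and> convex (modes g)"

definition unimodal :: "('a::real_normed_vector \<Rightarrow> ennreal) \<Rightarrow> bool" where
  "unimodal g \<longleftrightarrow> (\<exists>!m. m \<in> modes g)"


subsection \<open>Elliptical densities\<close>

definition positive_definite :: "real^'m^'m \<Rightarrow> bool" where
  "positive_definite A \<longleftrightarrow> transpose A = A \<and> (\<forall>x. x \<noteq> 0 \<longrightarrow> 0 < x \<bullet> (A *v x))"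

text \<open>A generator is a function on the positive half-line; the values of \<^term>\<open>f\<close>
  at arguments \<^term>\<open>x \<le> 0\<close> are never used.\<close>

definition density_generator :: "nat \<Rightarrow> (real \<Rightarrow> real) \<Rightarrow> bool" where
  "density_generator n f \<longleftrightarrow>
     (\<forall>x>0. 0 \<le> f x) \<and>
     set_integrable lborel {0<..} (\<lambda>x. x powr (real n / 2 - 1) * f x)"

definition gen_support :: "(real \<Rightarrow> real) \<Rightarrow> real set" where
  "gen_support f = {x. 0 < x \<and> 0 < f x}"

definition s_concave_generator :: "ereal \<Rightarrow> (real \<Rightarrow> real) \<Rightarrow> bool" where
  "s_concave_generator s f \<longleftrightarrow> s_concave_on (gen_support f) s (\<lambda>x. ennreal (f x))"

definition strictly_s_concave_generator :: "ereal \<Rightarrow> (real \<Rightarrow> real) \<Rightarrow> bool" where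
  "strictly_s_concave_generator s f \<longleftrightarrow> strictly_s_concave_on (gen_support f) s (\<lambda>x. ennreal (f x))"

text \<open>The generator is not defined at 0, the argument that gives the density at the
  origin. The value there is the limit from the right, possibly infinite, whenever that limit exists,
  as it does for monotone and for s-concave generators.\<close>

definition gen_ext :: "(real \<Rightarrow> real) \<Rightarrow> real \<Rightarrow> ennreal" where
  "gen_ext f x = (if 0 < x then ennreal (f x) else Limsup (at_right 0) (\<lambda>t. ennreal (f t)))"

definition elliptical_density :: "real^'m^'m \<Rightarrow> (real \<Rightarrow> real) \<Rightarrow> real^'m \<Rightarrow> ennreal" where
  "elliptical_density \<Omega> f y =
     gen_ext f (y \<bullet> (matrix_inv \<Omega> *v y))
       / (\<integral>\<^sup>+z. gen_ext f (z \<bullet> (matrix_inv \<Omega> *v z)) \<partial>lborel)"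


subsection \<open>Block structure, marginal and skew-elliptical densities\<close>

text \<open>In dimension d + 1 the index type is \<^typ>\<open>'n option\<close>, with \<^term>\<open>None\<close> for the first
  coordinate.\<close>

definition vcons :: "real \<Rightarrow> real^'n \<Rightarrow> real^('n option)" where
  "vcons a v = (\<chi> i. case i of None \<Rightarrow> a | Some j \<Rightarrow> v $ j)"

definition Omega_plus :: "real^'n \<Rightarrow> real^'n^'n \<Rightarrow> real^('n option)^('n option)" where
  "Omega_plus \<delta> \<Omega> =
     (\<chi> i. case i of None \<Rightarrow> vcons 1 \<delta> | Some k \<Rightarrow> vcons (\<delta> $ k) (\<Omega> $ k))"

definition marginal_density :: "(real^('n option) \<Rightarrow> ennreal) \<Rightarrow> real^'n \<Rightarrow> ennreal" where
  "marginal_density g v = (\<integral>\<^sup>+t. g (vcons t v) \<partial>lborel)"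

definition skew_density :: "(real^('n option) \<Rightarrow> ennreal) \<Rightarrow> real^'n \<Rightarrow> ennreal" where
  "skew_density g v = 2 * (\<integral>\<^sup>+t\<in>{0<..}. g (vcons t v) \<partial>lborel)"

end

theory Submission
  imports Defs
begin

text \<open>
  Write \<open>Q\<close> for the quadratic form of the inverse dispersion matrix and \<open>G\<close> for the generator
  extended to the argument 0 by its right limit, so that the joint density is \<open>k G(Q(y))\<close>.

  Convexity of the modes forces the origin to be a mode, because the density is even. An
  \<open>s\<close>-concave generator with finite \<open>s\<close> that has a local maximum at 0 cannot increase anywhere:
  a single increase would propagate down to 0 and make the generator strictly increasing there
  (\<open>generator_antimono\<close>). As \<open>Q\<close> is convex and \<open>G\<close> is non-increasing and \<open>s\<close>-concave, \<open>G \<circ> Q\<close> is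
  \<open>s\<close>-concave; it is strictly so once \<open>G\<close> decreases strictly on its support, because \<open>Q\<close> is strictly
  convex (\<open>strictly_s_concave_antimono_comp\<close>). Both unimodality and strict \<open>s\<close>-concavity of the
  generator give that strict decrease.

  The two densities of the last \<open>d\<close> coordinates are integrals of the joint density over lines or
  half-lines, and their concavity is an instance of the one-dimensional Borell-Brascamp-Lieb
  inequality (\<open>borell_brascamp_lieb\<close>). For the quasi-concave functions needed here it has a short proof:
  after division by their suprema the superlevel sets are intervals, whose lengths combine
  linearly; integrating over the levels gives a product of an \<open>s\<close>-mean and an arithmetic
  mean, and Hoelder's inequality turns this product into the mean of order \<open>s / (1 + s)\<close>.

  Strictness does not come from the equality cases of that inequality. Completing the square,
  \<open>Q(t, v) = \<alpha> (t - l(v))\<^sup>2 + q(v)\<close> with \<open>l\<close> linear and \<open>q\<close> strictly convex. The integral over \<open>t\<close> is a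
  function \<open>K(c, r)\<close> of the centre \<open>c = l(v)\<close> and the offset \<open>r = q(v)\<close>
  (\<open>slice_integral\<close>). Since \<open>\<alpha> (t - c)\<^sup>2 + r\<close> is jointly convex in \<open>(t, c, r)\<close>, the inequality already
  applies to \<open>K\<close> as a function of \<open>(c, r)\<close>, and replacing \<open>\<theta> q(x) + (1 - \<theta>) q(y)\<close> by the strictly smaller
  \<open>q(\<theta> x + (1 - \<theta>) y)\<close> strictly increases \<open>K\<close> as soon as \<open>G\<close> decreases strictly on its support or the
  support is bounded: in the second case a smaller offset lengthens the segment cut out by the support.
\<close>

section \<open>Power means of extended non-negative reals\<close>

lemma ennreal_powr_ennreal: "0 < x \<Longrightarrow> ennreal_powr (ennreal x) p = ennreal (x powr p)"
  by (simp add: ennreal_powr_def)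

lemma ennreal_powr_0_left [simp]:
  "0 < p \<Longrightarrow> ennreal_powr 0 p = 0" "p < 0 \<Longrightarrow> ennreal_powr 0 p = \<top>"
  by (simp_all add: ennreal_powr_def)

lemma ennreal_powr_top_left [simp]:
  "0 < p \<Longrightarrow> ennreal_powr \<top> p = \<top>" "p < 0 \<Longrightarrow> ennreal_powr \<top> p = 0"
  by (simp_all add: ennreal_powr_def)

lemma ennreal_powr_zero_right [simp]: "ennreal_powr a 0 = 1"
  by (simp add: ennreal_powr_def)

lemma ennreal_pos_cases [case_names zero top pos]:
  fixes a :: ennreal
  obtains "a = 0" | "a = \<top>" | x where "0 < x" "a = ennreal x"
  by (cases a) (metis ennreal_0 linorder_not_less order_le_less, blast)

lemma ennreal_powr_mono:
  assumes "0 \<le> p" "a \<le> b" shows "ennreal_powr a p \<le> ennreal_powr b p"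
proof (cases "p = 0")
  case False
  with assms have "0 < p" by simp
  with assms show ?thesis
    by (cases a rule: ennreal_pos_cases; cases b rule: ennreal_pos_cases)
       (auto simp: ennreal_powr_ennreal intro!: ennreal_leI powr_mono2 simp: top_unique)
qed simp

lemma ennreal_powr_antimono:
  assumes "p \<le> 0" "a \<le> b" shows "ennreal_powr b p \<le> ennreal_powr a p"
proof (cases "p = 0")
  case False
  with assms have "p < 0" by simp
  with assms show ?thesis
    by (cases a rule: ennreal_pos_cases; cases b rule: ennreal_pos_cases)
       (auto simp: ennreal_powr_ennreal intro!: ennreal_leI powr_mono2' simp: top_unique)
qed simp

text \<open>The boundary conventions at 0 and \<open>\<top>\<close> make \<open>a \<mapsto> a\<^sup>p\<close> an order isomorphism of the extended half-line for
  \<open>p > 0\<close> and an order reversal for \<open>p < 0\<close>, with the reciprocal power as inverse.\<close>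

lemma ennreal_powr_inverse:
  assumes "p \<noteq> 0" shows "ennreal_powr (ennreal_powr a p) (1 / p) = a"
  using assms
  by (cases a rule: ennreal_pos_cases; cases "p > 0")
     (auto simp: ennreal_powr_ennreal powr_powr)

lemma ennreal_powr_inverse':
  assumes "p \<noteq> 0" shows "ennreal_powr (ennreal_powr a (1 / p)) p = a"
  using ennreal_powr_inverse[of "1 / p" a] assms by simp

lemma ennreal_powr_mult:
  assumes "0 < k" "k < \<top>"
  shows "ennreal_powr (k * a) p = ennreal_powr k p * ennreal_powr a p"
proof -
  obtain c where c: "0 < c" "k = ennreal c"
    using assms by (cases k rule: ennreal_pos_cases) auto
  show ?thesis
  proof (cases a rule: ennreal_pos_cases)
    case zero
    then show ?thesis using c by (cases "p = 0"; cases "p > 0") (auto simp: ennreal_powr_ennreal ennreal_mult_top)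
  next
    case top
    then show ?thesis using c by (cases "p = 0"; cases "p > 0") (auto simp: ennreal_powr_ennreal ennreal_mult_top)
  next
    case (pos x)
    then show ?thesis using c
      by (simp add: ennreal_powr_ennreal powr_mult flip: ennreal_mult)
  qed
qed

lemma ennreal_powr_add:
  assumes "0 < p" "0 < q"
  shows "ennreal_powr a p * ennreal_powr a q = ennreal_powr a (p + q)"
  using assms
  by (cases a rule: ennreal_pos_cases)
     (auto simp: ennreal_powr_ennreal powr_add ennreal_top_mult ennreal_mult)

lemma ennreal_powr_one [simp]: "ennreal_powr a 1 = a"
  by (cases a rule: ennreal_pos_cases) (auto simp: ennreal_powr_ennreal)

text \<open>A monotone bijection of a linear order is continuous for the order topology: a bound on the power is
  equivalent to a bound on the base.\<close>

lemma tendsto_ennreal_powr: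
  assumes u: "(u \<longlongrightarrow> a) F"
  shows "((\<lambda>x. ennreal_powr (u x) p) \<longlongrightarrow> ennreal_powr a p) F"
proof -
  have inj: "ennreal_powr b p = ennreal_powr c p \<longleftrightarrow> b = c" if "p \<noteq> 0" for b c p
    using ennreal_powr_inverse[OF that] by metis
  have less: "ennreal_powr b p < ennreal_powr c p" if "0 < p" "b < c" for b c p
    using ennreal_powr_mono[of p b c] inj[of p b c] that by (auto simp: order_less_le)
  have less': "ennreal_powr c p < ennreal_powr b p" if "p < 0" "b < c" for b c p
    using ennreal_powr_antimono[of p b c] inj[of p b c] that by (auto simp: order_less_le)
  consider "p = 0" | "0 < p" | "p < 0" by linarith
  then show ?thesis
  proof cases
    case 1 then show ?thesis by simp
  next
    case 2
    show ?thesis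
    proof (rule order_tendstoI)
      fix y assume "y < ennreal_powr a p"
      then have "ennreal_powr y (1 / p) < a"
        using less[of "1 / p" y "ennreal_powr a p"] 2 by (simp add: ennreal_powr_inverse)
      from order_tendstoD(1)[OF u this] show "\<forall>\<^sub>F x in F. y < ennreal_powr (u x) p"
        by eventually_elim (use 2 less[of p] ennreal_powr_inverse'[of p y] in force)
    next
      fix y assume "ennreal_powr a p < y"
      then have "a < ennreal_powr y (1 / p)"
        using less[of "1 / p" "ennreal_powr a p" y] 2 by (simp add: ennreal_powr_inverse)
      from order_tendstoD(2)[OF u this] show "\<forall>\<^sub>F x in F. ennreal_powr (u x) p < y"
        by eventually_elim (use 2 less[of p] ennreal_powr_inverse'[of p y] in force)
    qed
  next
    case 3
    show ?thesis
    proof (rule order_tendstoI)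
      fix y assume "y < ennreal_powr a p"
      then have "a < ennreal_powr y (1 / p)"
        using less'[of "1 / p" y "ennreal_powr a p"] 3 by (simp add: ennreal_powr_inverse)
      from order_tendstoD(2)[OF u this] show "\<forall>\<^sub>F x in F. y < ennreal_powr (u x) p"
        by eventually_elim (use 3 less'[of p] ennreal_powr_inverse'[of p y] in force)
    next
      fix y assume "ennreal_powr a p < y"
      then have "ennreal_powr y (1 / p) < a"
        using less'[of "1 / p" "ennreal_powr a p" y] 3 by (simp add: ennreal_powr_inverse)
      from order_tendstoD(1)[OF u this] show "\<forall>\<^sub>F x in F. ennreal_powr (u x) p < y"
        by eventually_elim (use 3 less'[of p] ennreal_powr_inverse'[of p y] in force)
    qed
  qed
qed

lemma power_mean_0: "power_mean (ereal 0) \<theta> a b = ennreal_powr a \<theta> * ennreal_powr b (1 - \<theta>)"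
  by (simp add: power_mean_def)

lemma power_mean_ereal:
  "r \<noteq> 0 \<Longrightarrow> power_mean (ereal r) \<theta> a b =
     ennreal_powr (ennreal \<theta> * ennreal_powr a r + ennreal (1 - \<theta>) * ennreal_powr b r) (1 / r)"
  by (simp add: power_mean_def)

lemma power_mean_infinity [simp]:
  "power_mean (-\<infinity>) \<theta> a b = min a b" "power_mean \<infinity> \<theta> a b = max a b"
  by (simp_all add: power_mean_def)

lemma ereal_order_cases [case_names zero real minf pinf]:
  fixes s :: ereal
  obtains "s = ereal 0" | r where "r \<noteq> 0" "s = ereal r" | "s = -\<infinity>" | "s = \<infinity>"
  by (cases s) auto

lemma power_mean_mono:
  assumes \<theta>: "0 < \<theta>" "\<theta> < 1" and "a \<le> a'" "b \<le> b'"
  shows "power_mean s \<theta> a b \<le> power_mean s \<theta> a' b'"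
proof (cases s rule: ereal_order_cases)
  case zero
  then show ?thesis using assms by (auto simp: power_mean_0 intro!: mult_mono ennreal_powr_mono)
next
  case (real r)
  show ?thesis
  proof (cases "0 < r")
    case True
    then show ?thesis using assms real
      by (auto simp: power_mean_ereal intro!: add_mono mult_left_mono ennreal_powr_mono)
  next
    case False
    then show ?thesis using assms real
      by (auto simp: power_mean_ereal intro!: add_mono mult_left_mono ennreal_powr_antimono)
  qed
next
  case minf
  then show ?thesis using assms by (auto intro: min.coboundedI1 min.coboundedI2)
next
  case pinf
  then show ?thesis using assms by (auto intro: max.coboundedI1 max.coboundedI2)
qed

lemma power_mean_self:
  assumes \<theta>: "0 < \<theta>" "\<theta> < 1"
  shows "power_mean s \<theta> a a = a"
proof (cases s rule: ereal_order_cases)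
  case (real r)
  have "ennreal \<theta> * c + ennreal (1 - \<theta>) * c = c" for c
    using \<theta> by (simp flip: distrib_right ennreal_plus)
  then show ?thesis using real by (simp add: power_mean_ereal ennreal_powr_inverse)
qed (use \<theta> in \<open>simp_all add: power_mean_0 ennreal_powr_add\<close>)

lemma min_le_power_mean:
  assumes \<theta>: "0 < \<theta>" "\<theta> < 1"
  shows "min a b \<le> power_mean s \<theta> a b"
  using power_mean_mono[OF \<theta>, of "min a b" a "min a b" b s] power_mean_self[OF \<theta>]
  by simp

lemma power_mean_pos:
  assumes "0 < \<theta>" "\<theta> < 1" "0 < a" "0 < b"
  shows "0 < power_mean s \<theta> a b"
  using min_le_power_mean[OF assms(1,2), of a b s] assms(3,4) by (metis min_less_iff_conj order_less_le_trans)

lemma power_mean_cmult: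
  assumes k: "0 < k" "k < \<top>" and \<theta>: "0 < \<theta>" "\<theta> < 1"
  shows "power_mean s \<theta> (k * a) (k * b) = k * power_mean s \<theta> a b"
proof (cases s rule: ereal_order_cases)
  case zero
  have "ennreal_powr k \<theta> * ennreal_powr k (1 - \<theta>) = k"
    using \<theta> by (simp add: ennreal_powr_add)
  moreover have "power_mean s \<theta> (k * a) (k * b) =
      (ennreal_powr k \<theta> * ennreal_powr k (1 - \<theta>)) * (ennreal_powr a \<theta> * ennreal_powr b (1 - \<theta>))"
    unfolding zero power_mean_0 ennreal_powr_mult[OF k] by (simp only: mult_ac)
  ultimately show ?thesis
    unfolding zero power_mean_0 by simp
next
  case (real r)
  have "power_mean s \<theta> (k * a) (k * b) =
     ennreal_powr (ennreal_powr k r * (ennreal \<theta> * ennreal_powr a r + ennreal (1 - \<theta>) * ennreal_powr b r)) (1 / r)"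
    unfolding real(2) power_mean_ereal[OF real(1)] ennreal_powr_mult[OF k]
    by (simp only: distrib_left mult_ac)
  also have "\<dots> = k * power_mean s \<theta> a b"
  proof -
    have "0 < ennreal_powr k r" "ennreal_powr k r < \<top>"
      using k by (cases k rule: ennreal_pos_cases; simp add: ennreal_powr_ennreal)+
    then show ?thesis
      using real by (simp add: power_mean_ereal ennreal_powr_mult ennreal_powr_inverse)
  qed
  finally show ?thesis .
qed (simp_all add: mult_left_mono min_def max_def ennreal_mult_le_mult_iff k less_imp_neq[OF k(1), symmetric] less_imp_neq[OF k(2)])

text \<open>The limits may be infinite: the value of a density at a pole at the origin is such a limit, and so is a divergent
  integral after truncation. Positive limits exclude the product
  \<open>0 \<cdot> \<top>\<close> in the geometric mean.\<close>

lemma tendsto_power_mean: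
  assumes \<theta>: "0 < \<theta>" "\<theta> < 1" and "0 < a" "0 < b"
    and u: "(u \<longlongrightarrow> a) F" and v: "(v \<longlongrightarrow> b) F"
  shows "((\<lambda>x. power_mean s \<theta> (u x) (v x)) \<longlongrightarrow> power_mean s \<theta> a b) F"
proof (cases s rule: ereal_order_cases)
  case zero
  have pos: "ennreal_powr c t \<noteq> 0" if "0 < c" "0 < t" for c t
    using that by (cases c rule: ennreal_pos_cases) (auto simp: ennreal_powr_ennreal)
  have "((\<lambda>x. ennreal_powr (u x) \<theta> * ennreal_powr (v x) (1 - \<theta>)) \<longlongrightarrow>
     ennreal_powr a \<theta> * ennreal_powr b (1 - \<theta>)) F"
    by (intro tendsto_mult_ennreal tendsto_ennreal_powr u v) (use assms pos in auto)
  then show ?thesis using zero by (simp add: power_mean_0)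
next
  case (real r)
  then show ?thesis
    by (simp add: power_mean_ereal)
       (intro tendsto_ennreal_powr tendsto_add ennreal_tendsto_cmult u v; simp)
next
  case minf
  then show ?thesis using u v by (simp add: tendsto_min)
next
  case pinf
  then show ?thesis using u v by (simp add: tendsto_max)
qed

lemma power_mean_ennreal:
  assumes "r \<noteq> 0" "0 < x" "0 < y" "0 < \<theta>" "\<theta> < 1"
  shows "power_mean (ereal r) \<theta> (ennreal x) (ennreal y) =
     ennreal ((\<theta> * x powr r + (1 - \<theta>) * y powr r) powr (1 / r))"
proof -
  have "0 < \<theta> * x powr r + (1 - \<theta>) * y powr r"
    using assms by (intro add_pos_pos mult_pos_pos) auto
  then show ?thesis
    using assms by (simp add: power_mean_ereal ennreal_powr_ennreal flip: ennreal_mult ennreal_plus)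
qed

lemma power_mean_0_ennreal:
  assumes "0 < x" "0 < y"
  shows "power_mean (ereal 0) \<theta> (ennreal x) (ennreal y) = ennreal (x powr \<theta> * y powr (1 - \<theta>))"
  using assms by (simp add: power_mean_0 ennreal_powr_ennreal ennreal_mult)

text \<open>A mean of finite order lies strictly above a common lower bound that one argument exceeds. The minimum, of
  order \<open>-\<infinity>\<close>, lacks this property.\<close>

lemma less_power_mean:
  assumes \<theta>: "0 < \<theta>" "\<theta> < 1" and c: "0 < c" "c < \<top>" "c \<le> a" "c < b"
  shows "c < power_mean (ereal r) \<theta> a b"
proof -
  obtain x where x: "0 < x" "c = ennreal x" using c by (cases c rule: ennreal_pos_cases) auto
  obtain b' where b': "c < b'" "b' \<le> b" "b' < \<top>"
    using c dense[of c b] by (meson order_less_le order_less_le_trans top_greatest)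
  then obtain y where y: "0 < y" "b' = ennreal y" using c by (cases b' rule: ennreal_pos_cases) auto
  have xy: "x < y" using b' x y by (simp add: ennreal_less_iff)
  have "c < power_mean (ereal r) \<theta> c b'"
  proof (cases "r = 0")
    case True
    have "x = x powr \<theta> * x powr (1 - \<theta>)" using x by (simp flip: powr_add)
    also have "\<dots> < x powr \<theta> * y powr (1 - \<theta>)"
      using x xy \<theta> by (intro mult_strict_left_mono powr_less_mono2) auto
    finally show ?thesis
      using x y True \<theta> by (simp add: power_mean_0_ennreal ennreal_less_iff)
  next
    case False
    have eq: "x = (\<theta> * x powr r + (1 - \<theta>) * x powr r) powr (1 / r)"
      using x False by (simp add: powr_powr flip: distrib_right)
    have pos: "0 < \<theta> * x powr r + (1 - \<theta>) * z powr r" if "0 < z" for z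
      using x \<theta> that by (intro add_pos_pos mult_pos_pos) auto
    have "x < (\<theta> * x powr r + (1 - \<theta>) * y powr r) powr (1 / r)"
    proof (cases "0 < r")
      case True
      then have "x powr r < y powr r" using x xy by (intro powr_less_mono2) auto
      then show ?thesis
        using True \<theta> pos[of x] x by (subst eq) (intro powr_less_mono2, auto)
    next
      case neg: False
      then have "y powr r < x powr r" using x xy False by (intro powr_less_mono2_neg) auto
      then show ?thesis
        using False neg \<theta> pos[of y] y by (subst eq) (intro powr_less_mono2_neg, auto)
    qed
    then show ?thesis using x y \<theta> False by (simp add: power_mean_ennreal ennreal_less_iff)
  qed
  also have "\<dots> \<le> power_mean (ereal r) \<theta> a b" using c b' \<theta> by (intro power_mean_mono)
  finally show ?thesis .
qed

section \<open>Hoelder's inequality for power means\<close>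

text \<open>The order of concavity that remains when one coordinate of an \<open>s\<close>-concave function is integrated out. The value at
  \<open>s = -1\<close> is the limit of the quotient from the right.\<close>

definition marginal_order :: "real \<Rightarrow> ereal" where
  "marginal_order s = (if s = -1 then -\<infinity> else ereal (s / (1 + s)))"

text \<open>After scaling to arithmetic mean 1 this is the tangent line of \<open>t \<mapsto> t\<^sup>r\<close> at 1, which lies above the
  power for \<open>0 < r < 1\<close> and below it for \<open>r < 0\<close>.\<close>

lemma power_mean_le_arithmetic_mean:
  fixes x y w r :: real
  assumes "0 < x" "0 < y" "0 < w" "w < 1" "r < 1" "r \<noteq> 0"
  shows "(w * x powr r + (1 - w) * y powr r) powr (1 / r) \<le> w * x + (1 - w) * y"
proof -
  define m where "m = w * x + (1 - w) * y"
  have m: "0 < m" unfolding m_def using assms by (intro add_pos_pos mult_pos_pos) auto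
  define S where "S = w * (x / m) powr r + (1 - w) * (y / m) powr r"
  have S: "0 < S" unfolding S_def using assms m by (intro add_pos_pos mult_pos_pos) auto
  \<comment> \<open>The tangent line of \<open>t \<mapsto> t\<^sup>r\<close> at 1, averaged over \<open>x / m\<close> and \<open>y / m\<close>.\<close>
  have eq: "w * (1 + r * (x / m - 1)) + (1 - w) * (1 + r * (y / m - 1)) = 1"
  proof -
    have "w * (1 + r * (x / m - 1)) + (1 - w) * (1 + r * (y / m - 1)) = 1 + r * ((w * x + (1 - w) * y) / m - 1)"
      by (simp add: algebra_simps add_divide_distrib diff_divide_distrib)
    then show ?thesis using m by (simp flip: m_def)
  qed
  have "S powr (1 / r) \<le> 1"
  proof (cases "0 < r")
    case True
    have "t powr r \<le> 1 + r * (t - 1)" if "0 < t" for t :: real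
      using Youngs_inequality_0[of r "1 - r" t 1] True assms that by (simp add: algebra_simps)
    then have "S \<le> w * (1 + r * (x / m - 1)) + (1 - w) * (1 + r * (y / m - 1))"
      unfolding S_def using assms m by (intro add_mono mult_left_mono) auto
    then have "S \<le> 1" unfolding eq .
    then show ?thesis using True S powr_mono2[of "1 / r" S 1] by simp
  next
    case False
    have "1 + r * (t - 1) \<le> t powr r" if "0 < t" for t :: real
    proof -
      have "r * (t - 1) \<le> r * ln t"
        using False that ln_le_minus_one[of t] by (intro mult_left_mono_neg) auto
      also have "1 + r * ln t \<le> t powr r" using that by (simp add: powr_def)
      finally show ?thesis by simp
    qed
    then have "w * (1 + r * (x / m - 1)) + (1 - w) * (1 + r * (y / m - 1)) \<le> S"
      unfolding S_def using assms m by (intro add_mono mult_left_mono) auto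
    then have "1 \<le> S" unfolding eq .
    then show ?thesis using False assms powr_mono2'[of "1 / r" 1 S] by simp
  qed
  moreover have "w * x powr r + (1 - w) * y powr r = m powr r * S"
    using m assms by (simp add: S_def powr_divide distrib_left)
  ultimately have "(w * x powr r + (1 - w) * y powr r) powr (1 / r) \<le> m * 1"
    using m S assms by (simp add: powr_mult powr_powr)
  then show ?thesis by (simp add: m_def)
qed

text \<open>Hoelder's inequality for two terms, uniformly in the sign of \<open>s\<close>: reweighting by the terms
  of the \<open>s\<close>-mean reduces it to the comparison of the mean of order \<open>s / (1 + s) < 1\<close> with the arithmetic mean.\<close>

lemma power_mean_hoelder:
  fixes A B c d s \<theta> :: real
  assumes s: "-1 \<le> s" and \<theta>: "0 < \<theta>" "\<theta> < 1" and pos: "0 < A" "0 < B" "0 < c" "0 < d"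
  shows "power_mean (marginal_order s) \<theta> (ennreal (A * c)) (ennreal (B * d))
    \<le> power_mean (ereal s) \<theta> (ennreal A) (ennreal B) * ennreal (\<theta> * c + (1 - \<theta>) * d)"
proof (cases "s = 0")
  case True
  have "(A * c) powr \<theta> * (B * d) powr (1 - \<theta>) = A powr \<theta> * B powr (1 - \<theta>) * (c powr \<theta> * d powr (1 - \<theta>))"
    using pos by (simp add: powr_mult)
  also have "\<dots> \<le> A powr \<theta> * B powr (1 - \<theta>) * (\<theta> * c + (1 - \<theta>) * d)"
    using Youngs_inequality_0[of \<theta> "1 - \<theta>" c d] pos \<theta> by (intro mult_left_mono) auto
  finally show ?thesis
    using True pos \<theta>
    by (simp add: marginal_order_def power_mean_0_ennreal[unfolded zero_ereal_def[symmetric]] zero_ereal_def[symmetric]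
        ennreal_leI del: ennreal_plus flip: ennreal_mult)
next
  case s0: False
  define S where "S = \<theta> * A powr s + (1 - \<theta>) * B powr s"
  have S: "0 < S" unfolding S_def using pos \<theta> by (intro add_pos_pos mult_pos_pos) auto
  define w where "w = \<theta> * A powr s / S"
  have w1: "1 - w = (1 - \<theta>) * B powr s / S" using S by (simp add: w_def S_def field_simps)
  have "\<theta> * A powr s < S" using pos \<theta> by (simp add: S_def)
  then have w: "0 < w" "w < 1"
    using S pos \<theta> by (simp_all add: w_def)
  \<comment> \<open>The weights \<open>w\<close> and \<open>1 - w\<close> turn the claim into the comparison of two means of \<open>X\<close> and \<open>Y\<close>.\<close>
  define X Y where "X = c / A powr s" and "Y = d / B powr s"
  have XY: "0 < X" "0 < Y" using pos by (auto simp: X_def Y_def)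
  have arith: "\<theta> * c + (1 - \<theta>) * d = S * (w * X + (1 - w) * Y)"
    unfolding w1 using pos S by (simp add: w_def X_def Y_def distrib_left)
  have Ac: "A * c = A powr (1 + s) * X" "B * d = B powr (1 + s) * Y"
    using pos by (simp_all add: X_def Y_def powr_add)
  show ?thesis
  proof (cases "s = -1")
    case True
    have "min (A * c) (B * d) = min X Y" using Ac True pos by simp
    also have "\<dots> \<le> w * X + (1 - w) * Y"
    proof -
      have "w * min X Y + (1 - w) * min X Y \<le> w * X + (1 - w) * Y"
        using w by (intro add_mono mult_left_mono) auto
      then show ?thesis by (simp add: algebra_simps)
    qed
    also have "\<dots> = S powr (1 / s) * (\<theta> * c + (1 - \<theta>) * d)"
      unfolding arith using S True by (simp add: powr_minus_divide)
    finally show ?thesis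
      using True pos \<theta> S XY w s0 unfolding S_def
      by (simp add: marginal_order_def power_mean_ennreal min_ennreal ennreal_leI del: ennreal_plus flip: ennreal_mult)
  next
    case False
    then have s1: "-1 < s" using s by simp
    define r where "r = s / (1 + s)"
    have r: "r < 1" "r \<noteq> 0" "1 / r = 1 + 1 / s" "(1 + s) * r = s"
      using s1 s0 by (auto simp: r_def field_simps)
    have "(\<theta> * (A * c) powr r + (1 - \<theta>) * (B * d) powr r) =
        \<theta> * A powr s * X powr r + (1 - \<theta>) * B powr s * Y powr r"
      unfolding Ac using pos XY r(4) by (simp add: powr_mult powr_powr)
    also have "\<dots> = S * (w * X powr r + (1 - w) * Y powr r)"
      unfolding w1 using S by (simp add: w_def distrib_left)
    finally have "(\<theta> * (A * c) powr r + (1 - \<theta>) * (B * d) powr r) powr (1 / r)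
        = (S * (w * X powr r + (1 - w) * Y powr r)) powr (1 / r)" by simp
    also have "\<dots> = S powr (1 / r) * (w * X powr r + (1 - w) * Y powr r) powr (1 / r)"
      using S w XY by (intro powr_mult)
    also have "\<dots> \<le> S powr (1 / r) * (w * X + (1 - w) * Y)"
      using power_mean_le_arithmetic_mean[of X Y w r] XY w r by (intro mult_left_mono) auto
    also have "\<dots> = S powr (1 / s) * (\<theta> * c + (1 - \<theta>) * d)"
      unfolding arith r(3) using S by (simp add: powr_add)
    finally show ?thesis
      using False pos \<theta> S XY w s0 r unfolding S_def marginal_order_def
      by (simp add: power_mean_ennreal ennreal_leI del: ennreal_plus flip: ennreal_mult r_def)
  qed
qed

section \<open>The Borell-Brascamp-Lieb inequality on the line\<close>

text \<open>The one-dimensional Brunn-Minkowski inequality for intervals: a convex combination of two intervals contains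
  the open interval between the convex combinations of their endpoints.\<close>

lemma emeasure_interval_combination_ge:
  fixes I J S :: "real set"
  assumes \<theta>: "0 < \<theta>" "\<theta> < 1"
    and I: "convex I" "I \<noteq> {}" "bounded I" and J: "convex J" "J \<noteq> {}" "bounded J"
    and S: "S \<in> sets lborel" "\<And>x y. x \<in> I \<Longrightarrow> y \<in> J \<Longrightarrow> \<theta> * x + (1 - \<theta>) * y \<in> S"
  shows "ennreal \<theta> * emeasure lborel I + ennreal (1 - \<theta>) * emeasure lborel J \<le> emeasure lborel S"
proof -
  define a b c d where "a = Inf I" and "b = Sup I" and "c = Inf J" and "d = Sup J"
  have bd: "bdd_below I" "bdd_above I" "bdd_below J" "bdd_above J"
    using I J by (simp_all add: bounded_imp_bdd_above bounded_imp_bdd_below)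
  have ab: "a \<le> b" and cd: "c \<le> d"
    using cInf_le_cSup[of I] cInf_le_cSup[of J] I J bd by (simp_all add: a_def b_def c_def d_def)
  have sub: "I \<subseteq> {a..b}" "J \<subseteq> {c..d}"
    using bd by (auto simp: a_def b_def c_def d_def intro: cInf_lower cSup_upper)
  define T where "T = {z. \<exists>x\<in>I. \<exists>y\<in>J. z = \<theta> * x + (1 - \<theta>) * y}"
  have "T = (\<Union>u\<in>(\<lambda>x. \<theta> *\<^sub>R x) ` I. \<Union>v\<in>(\<lambda>x. (1 - \<theta>) *\<^sub>R x) ` J. {u + v})"
    by (auto simp: T_def)
  then have "convex T"
    using convex_sums[OF convex_scaling[OF I(1), of \<theta>] convex_scaling[OF J(1), of "1 - \<theta>"]] by simp
  then have T: "is_interval T" by (simp add: is_interval_convex_1)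
  have "{\<theta> * a + (1 - \<theta>) * c <..< \<theta> * b + (1 - \<theta>) * d} \<subseteq> T"
  proof
    fix z assume z: "z \<in> {\<theta> * a + (1 - \<theta>) * c <..< \<theta> * b + (1 - \<theta>) * d}"
    define e where "e = z - (\<theta> * a + (1 - \<theta>) * c)"
    have "0 < e" using z by (simp add: e_def)
    then obtain x1 y1 where xy1: "x1 \<in> I" "x1 < a + e" "y1 \<in> J" "y1 < c + e"
      using cInf_lessD[of I "a + e"] cInf_lessD[of J "c + e"] I J by (auto simp: a_def c_def)
    have "\<theta> * x1 + (1 - \<theta>) * y1 < \<theta> * (a + e) + (1 - \<theta>) * (c + e)"
      using xy1 \<theta> by (intro add_strict_mono mult_strict_left_mono) auto
    then have lo: "\<theta> * x1 + (1 - \<theta>) * y1 < z" by (simp add: e_def algebra_simps)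
    define e' where "e' = \<theta> * b + (1 - \<theta>) * d - z"
    have "0 < e'" using z by (simp add: e'_def)
    then obtain x2 y2 where xy2: "x2 \<in> I" "b - e' < x2" "y2 \<in> J" "d - e' < y2"
      using less_cSupD[of I "b - e'"] less_cSupD[of J "d - e'"] I J by (auto simp: b_def d_def)
    have "\<theta> * (b - e') + (1 - \<theta>) * (d - e') < \<theta> * x2 + (1 - \<theta>) * y2"
      using xy2 \<theta> by (intro add_strict_mono mult_strict_left_mono) auto
    then have hi: "z < \<theta> * x2 + (1 - \<theta>) * y2" by (simp add: e'_def algebra_simps)
    have "\<theta> * x1 + (1 - \<theta>) * y1 \<in> T" "\<theta> * x2 + (1 - \<theta>) * y2 \<in> T"
      using xy1 xy2 by (auto simp: T_def)
    then show "z \<in> T" using T lo hi by (meson is_interval_1 less_imp_le)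
  qed
  also have "T \<subseteq> S" using S(2) by (auto simp: T_def)
  finally have "emeasure lborel {\<theta> * a + (1 - \<theta>) * c <..< \<theta> * b + (1 - \<theta>) * d} \<le> emeasure lborel S"
    using S(1) by (intro emeasure_mono)
  moreover have "emeasure lborel {\<theta> * a + (1 - \<theta>) * c <..< \<theta> * b + (1 - \<theta>) * d}
      = ennreal (\<theta> * (b - a) + (1 - \<theta>) * (d - c))"
  proof -
    have "\<theta> * a + (1 - \<theta>) * c \<le> \<theta> * b + (1 - \<theta>) * d"
      using \<theta> ab cd by (intro add_mono mult_left_mono) auto
    then show ?thesis by (simp add: algebra_simps)
  qed
  moreover have "ennreal \<theta> * emeasure lborel I + ennreal (1 - \<theta>) * emeasure lborel J
      \<le> ennreal \<theta> * ennreal (b - a) + ennreal (1 - \<theta>) * ennreal (d - c)"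
    using emeasure_mono[OF sub(1), of lborel] emeasure_mono[OF sub(2), of lborel] ab cd
    by (intro add_mono mult_left_mono) auto
  moreover have "\<dots> = ennreal (\<theta> * (b - a) + (1 - \<theta>) * (d - c))"
    using \<theta> ab cd by (simp flip: ennreal_mult ennreal_plus)
  ultimately show ?thesis by simp
qed

text \<open>Only levels in \<open>(0, 1)\<close> are integrated. Below the supremum of a normalised function no
  superlevel set is empty, and this is what the Brunn-Minkowski inequality for intervals requires.\<close>

lemma nn_integral_min_1_layer_cake:
  fixes \<psi> :: "real \<Rightarrow> ennreal"
  assumes [measurable]: "\<psi> \<in> borel_measurable borel"
  shows "(\<integral>\<^sup>+t. min (\<psi> t) 1 \<partial>lborel) =
    (\<integral>\<^sup>+l\<in>{0<..<1}. emeasure lborel {t. ennreal l \<le> \<psi> t} \<partial>lborel)"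
proof -
  have "min (\<psi> t) 1 = (\<integral>\<^sup>+l. indicator {0<..<1} l * indicator {l. ennreal l \<le> \<psi> t} l \<partial>lborel)" for t
  proof -
    define m where "m = enn2real (min (\<psi> t) 1)"
    have lt: "min (\<psi> t) 1 < \<top>" by (simp add: min_less_iff_disj)
    have m: "0 \<le> m" "m \<le> 1" "ennreal m = min (\<psi> t) 1"
      using lt enn2real_mono[of "min (\<psi> t) 1" 1] by (simp_all add: m_def)
    have iff: "ennreal l \<le> \<psi> t \<longleftrightarrow> l \<le> m" if "0 < l" "l < 1" for l
    proof -
      have "ennreal l \<le> \<psi> t \<longleftrightarrow> ennreal l \<le> ennreal m"
        using that by (simp only: m(3) min.bounded_iff) simp
      then show ?thesis unfolding ennreal_le_iff[OF m(1)] .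
    qed
    have "(\<integral>\<^sup>+l. indicator {0<..<1} l * indicator {l. ennreal l \<le> \<psi> t} l \<partial>lborel)
        = (\<integral>\<^sup>+l. indicator ({0<..<1} \<inter> {..m}) l \<partial>lborel)"
      by (intro nn_integral_cong) (auto simp: indicator_def iff)
    also have "\<dots> = emeasure lborel ({0<..<1} \<inter> {..m})" by simp
    also have "\<dots> = ennreal m"
    proof (cases "m = 1")
      case True
      then have "{0<..<1} \<inter> {..m} = {0<..<1::real}" by auto
      then show ?thesis using True by simp
    next
      case False
      then have "{0<..<1} \<inter> {..m} = {0<..m}" using m by auto
      then show ?thesis using m by simp
    qed
    finally show ?thesis using m by simp
  qed
  then have "(\<integral>\<^sup>+t. min (\<psi> t) 1 \<partial>lborel) =
    (\<integral>\<^sup>+t. \<integral>\<^sup>+l. indicator {0<..<1} l * indicator {l. ennreal l \<le> \<psi> t} l \<partial>lborel \<partial>lborel)"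
    by simp
  also have "\<dots> = (\<integral>\<^sup>+l. \<integral>\<^sup>+t. indicator {0<..<1} l * indicator {t. ennreal l \<le> \<psi> t} t \<partial>lborel \<partial>lborel)"
    by (subst lborel_pair.Fubini') (auto simp: indicator_def intro!: nn_integral_cong)
  also have "\<dots> = (\<integral>\<^sup>+l\<in>{0<..<1}. emeasure lborel {t. ennreal l \<le> \<psi> t} \<partial>lborel)"
    by (simp add: nn_integral_cmult mult.commute)
  finally show ?thesis .
qed

lemma borel_measurable_emeasure_superlevel:
  fixes \<psi> :: "real \<Rightarrow> ennreal"
  assumes [measurable]: "\<psi> \<in> borel_measurable borel"
  shows "(\<lambda>l. emeasure lborel {t. ennreal l \<le> \<psi> t}) \<in> borel_measurable borel"
proof -
  have "(\<lambda>l. emeasure lborel {t. ennreal l \<le> \<psi> t}) =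
      (\<lambda>l. \<integral>\<^sup>+t. indicator {p. ennreal (fst p) \<le> \<psi> (snd p)} (l, t) \<partial>lborel)"
  proof
    fix l
    have "emeasure lborel {t. ennreal l \<le> \<psi> t} = (\<integral>\<^sup>+t. indicator {t. ennreal l \<le> \<psi> t} t \<partial>lborel)"
      by (rule nn_integral_indicator[symmetric]) simp
    then show "emeasure lborel {t. ennreal l \<le> \<psi> t} =
        (\<integral>\<^sup>+t. indicator {p. ennreal (fst p) \<le> \<psi> (snd p)} (l, t) \<partial>lborel)"
      by (simp add: indicator_def)
  qed
  also have "\<dots> \<in> borel_measurable borel"
    by (rule lborel.borel_measurable_nn_integral) measurable
  finally show ?thesis .
qed

text \<open>Boundedness makes the suprema \<open>A\<close> and \<open>B\<close> finite, so that both functions can be normalised. With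
  \<open>m\<close> the \<open>s\<close>-mean of \<open>A\<close> and \<open>B\<close>, homogeneity of the mean shows that the \<open>l m\<close>-superlevel set of \<open>\<phi>\<close> contains
  the convex combination of the \<open>l A\<close>- and \<open>l B\<close>-superlevel sets of \<open>\<phi>0\<close> and \<open>\<phi>1\<close>.\<close>

lemma borell_brascamp_lieb_bounded:
  fixes \<phi>0 \<phi>1 \<phi> :: "real \<Rightarrow> ennreal" and s \<theta> R :: real
  assumes s: "-1 \<le> s" and \<theta>: "0 < \<theta>" "\<theta> < 1"
    and meas [measurable]: "\<phi>0 \<in> borel_measurable borel" "\<phi>1 \<in> borel_measurable borel" "\<phi> \<in> borel_measurable borel"
    and quasi: "\<And>l. 0 < l \<Longrightarrow> convex {t. l \<le> \<phi>0 t}" "\<And>l. 0 < l \<Longrightarrow> convex {t. l \<le> \<phi>1 t}"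
    and bound: "\<And>t. \<phi>0 t \<le> ennreal R" "\<And>t. \<phi>1 t \<le> ennreal R"
    and supp: "\<And>t. 0 < \<phi>0 t \<Longrightarrow> t \<in> {-R..R}" "\<And>t. 0 < \<phi>1 t \<Longrightarrow> t \<in> {-R..R}"
    and mean: "\<And>x y. 0 < \<phi>0 x \<Longrightarrow> 0 < \<phi>1 y \<Longrightarrow>
      power_mean (ereal s) \<theta> (\<phi>0 x) (\<phi>1 y) \<le> \<phi> (\<theta> * x + (1 - \<theta>) * y)"
    and pos: "0 < (\<integral>\<^sup>+t. \<phi>0 t \<partial>lborel)" "0 < (\<integral>\<^sup>+t. \<phi>1 t \<partial>lborel)"
  shows "power_mean (marginal_order s) \<theta> (\<integral>\<^sup>+t. \<phi>0 t \<partial>lborel) (\<integral>\<^sup>+t. \<phi>1 t \<partial>lborel)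
    \<le> (\<integral>\<^sup>+t. \<phi> t \<partial>lborel)"
proof -
  have sup: "\<exists>A>0. (SUP t. h t) = ennreal A"
    if "\<And>t. h t \<le> ennreal R" "0 < (\<integral>\<^sup>+t. h t \<partial>lborel)" for h :: "real \<Rightarrow> ennreal"
  proof (cases "SUP t. h t" rule: ennreal_pos_cases)
    case zero
    then have "h = (\<lambda>t. 0)" by (auto simp: fun_eq_iff SUP_eq_iff bot_ennreal[symmetric])
    then show ?thesis using that(2) by simp
  next
    case top
    moreover have "(SUP t. h t) \<le> ennreal R" using that(1) by (intro SUP_least)
    ultimately have "\<top> \<le> ennreal R" by (simp only:)
    then show ?thesis by (simp add: top_unique)
  qed auto
  obtain A where A: "0 < A" "(SUP t. \<phi>0 t) = ennreal A" using sup[OF bound(1) pos(1)] by blast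
  obtain B where B: "0 < B" "(SUP t. \<phi>1 t) = ennreal B" using sup[OF bound(2) pos(2)] by blast
  define m where "m = power_mean (ereal s) \<theta> (ennreal A) (ennreal B)"
  have m: "0 < m" "m < \<top>"
  proof -
    show "0 < m" unfolding m_def using A B \<theta> by (intro power_mean_pos) auto
    have "m \<le> power_mean (ereal s) \<theta> (ennreal (max A B)) (ennreal (max A B))"
      unfolding m_def using \<theta> by (intro power_mean_mono) (auto intro: ennreal_leI)
    then show "m < \<top>" using \<theta> by (simp add: power_mean_self order_le_less_trans[OF _ ennreal_less_top])
  qed
  define \<psi>0 \<psi>1 \<psi> where "\<psi>0 t = \<phi>0 t / ennreal A" and "\<psi>1 t = \<phi>1 t / ennreal B" and "\<psi> t = \<phi> t / m" for t
  have [measurable]: "\<psi>0 \<in> borel_measurable borel" "\<psi>1 \<in> borel_measurable borel" "\<psi> \<in> borel_measurable borel"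
    unfolding \<psi>0_def \<psi>1_def \<psi>_def by measurable
  have le_div: "ennreal l \<le> h / k \<longleftrightarrow> ennreal l * k \<le> h" if "0 < k" "k < \<top>" for l h k
  proof -
    have "h / k * k = h" using that by (simp add: ennreal_divide_times)
    moreover have "ennreal l * k / k = ennreal l" using that by (intro mult_divide_eq_ennreal) auto
    ultimately show ?thesis
      using mult_right_mono[of "ennreal l" "h / k" k] divide_right_mono_ennreal[of "ennreal l * k" h k] by auto
  qed
  have level: "ennreal \<theta> * emeasure lborel {t. ennreal l \<le> \<psi>0 t} + ennreal (1 - \<theta>) * emeasure lborel {t. ennreal l \<le> \<psi>1 t}
      \<le> emeasure lborel {t. ennreal l \<le> \<psi> t}" if l: "0 < l" "l < 1" for l
  proof -
    have conv: "convex {t. ennreal l \<le> h t / ennreal C} \<and> {t. ennreal l \<le> h t / ennreal C} \<noteq> {} \<and>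
        bounded {t. ennreal l \<le> h t / ennreal C}"
      if C: "0 < C" "(SUP t. h t) = ennreal C" and q: "\<And>l. 0 < l \<Longrightarrow> convex {t. l \<le> h t}"
        and b: "\<And>t. 0 < h t \<Longrightarrow> t \<in> {-R..R}" for h C
    proof -
      have eq: "{t. ennreal l \<le> h t / ennreal C} = {t. ennreal (l * C) \<le> h t}"
        using C l by (simp add: le_div ennreal_mult)
      have "ennreal (l * C) < (SUP t. h t)" using C l by (simp add: ennreal_less_iff)
      then obtain t where "ennreal (l * C) < h t" by (auto simp: less_SUP_iff)
      then have "{t. ennreal (l * C) \<le> h t} \<noteq> {}" by (auto intro: less_imp_le)
      moreover have "{t. ennreal (l * C) \<le> h t} \<subseteq> {-R..R}"
      proof
        fix t assume "t \<in> {t. ennreal (l * C) \<le> h t}"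
        moreover have "0 < ennreal (l * C)" using l C by simp
        ultimately have "0 < h t" using order_less_le_trans by blast
        then show "t \<in> {-R..R}" by (rule b)
      qed
      ultimately show ?thesis
        using q[of "ennreal (l * C)"] l C unfolding eq by (auto intro: bounded_subset[OF bounded_closed_interval])
    qed
    show ?thesis
    proof (rule emeasure_interval_combination_ge[OF \<theta>])
      fix x y assume "x \<in> {t. ennreal l \<le> \<psi>0 t}" "y \<in> {t. ennreal l \<le> \<psi>1 t}"
      then have xy: "ennreal l * ennreal A \<le> \<phi>0 x" "ennreal l * ennreal B \<le> \<phi>1 y"
        using A B by (simp_all add: \<psi>0_def \<psi>1_def le_div)
      then have "0 < \<phi>0 x" "0 < \<phi>1 y"
        using A B l by (simp_all add: order_less_le_trans[OF _ xy(1)] order_less_le_trans[OF _ xy(2)] ennreal_zero_less_mult_iff)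
      note mean[OF this]
      moreover have "ennreal l * m = power_mean (ereal s) \<theta> (ennreal l * ennreal A) (ennreal l * ennreal B)"
        using l \<theta> unfolding m_def by (intro power_mean_cmult[symmetric]) auto
      moreover have "\<dots> \<le> power_mean (ereal s) \<theta> (\<phi>0 x) (\<phi>1 y)"
        using xy \<theta> by (intro power_mean_mono)
      ultimately show "\<theta> * x + (1 - \<theta>) * y \<in> {t. ennreal l \<le> \<psi> t}"
        using m by (simp add: \<psi>_def le_div)
    qed (use conv[OF A quasi(1) supp(1)] conv[OF B quasi(2) supp(2)] in \<open>auto simp: \<psi>0_def \<psi>1_def\<close>)
  qed
  have le1: "\<psi>0 t \<le> 1" "\<psi>1 t \<le> 1" for t
  proof -
    have "h t / ennreal C \<le> 1" if "0 < C" "(SUP t. h t) = ennreal C" for h :: "real \<Rightarrow> ennreal" and C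
      using that SUP_upper[of t UNIV h] by (metis UNIV_I divide_right_mono_ennreal ennreal_divide_self ennreal_less_top ennreal_less_zero_iff less_numeral_extra(3))
    from this[OF A] this[OF B] show "\<psi>0 t \<le> 1" "\<psi>1 t \<le> 1" by (simp_all add: \<psi>0_def \<psi>1_def)
  qed
  let ?E = "\<lambda>h l. emeasure lborel {t. ennreal l \<le> h t}"
  have cake: "(\<integral>\<^sup>+t. h t \<partial>lborel) = (\<integral>\<^sup>+l\<in>{0<..<1}. ?E h l \<partial>lborel)"
    if "h \<in> borel_measurable borel" "\<And>t. h t \<le> 1" for h :: "real \<Rightarrow> ennreal"
  proof -
    have "(\<integral>\<^sup>+t. h t \<partial>lborel) = (\<integral>\<^sup>+t. min (h t) 1 \<partial>lborel)"
      using that(2) by (simp add: min_absorb1)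
    then show ?thesis using nn_integral_min_1_layer_cake[OF that(1)] by simp
  qed
  note [measurable] = borel_measurable_emeasure_superlevel[of \<psi>0] borel_measurable_emeasure_superlevel[of \<psi>1]
  have "ennreal \<theta> * (\<integral>\<^sup>+t. \<psi>0 t \<partial>lborel) + ennreal (1 - \<theta>) * (\<integral>\<^sup>+t. \<psi>1 t \<partial>lborel)
      = (\<integral>\<^sup>+l. ennreal \<theta> * (?E \<psi>0 l * indicator {0<..<1} l) + ennreal (1 - \<theta>) * (?E \<psi>1 l * indicator {0<..<1} l) \<partial>lborel)"
    by (simp add: cake le1 nn_integral_add nn_integral_cmult)
  also have "\<dots> \<le> (\<integral>\<^sup>+l\<in>{0<..<1}. ?E \<psi> l \<partial>lborel)"
    by (intro nn_integral_mono) (auto simp: indicator_def intro: level)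
  also have "\<dots> = (\<integral>\<^sup>+t. min (\<psi> t) 1 \<partial>lborel)"
    by (rule nn_integral_min_1_layer_cake[symmetric]) measurable
  also have "\<dots> \<le> (\<integral>\<^sup>+t. \<psi> t \<partial>lborel)" by (intro nn_integral_mono) simp
  finally have main: "ennreal \<theta> * (\<integral>\<^sup>+t. \<psi>0 t \<partial>lborel) + ennreal (1 - \<theta>) * (\<integral>\<^sup>+t. \<psi>1 t \<partial>lborel)
      \<le> (\<integral>\<^sup>+t. \<phi> t \<partial>lborel) / m"
    by (simp add: \<psi>_def nn_integral_divide)
  have fin: "\<exists>c>0. (\<integral>\<^sup>+t. h t \<partial>lborel) = ennreal C * ennreal c \<and> (\<integral>\<^sup>+t. h t / ennreal C \<partial>lborel) = ennreal c"
    if "0 < C" "h \<in> borel_measurable borel" "\<And>t. h t \<le> ennreal R" "\<And>t. 0 < h t \<Longrightarrow> t \<in> {-R..R}"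
      "0 < (\<integral>\<^sup>+t. h t \<partial>lborel)" for h C
  proof -
    note [measurable] = that(2) and pos_h = that(5)
    have "(\<integral>\<^sup>+t. h t \<partial>lborel) \<le> (\<integral>\<^sup>+t. ennreal R * indicator {-R..R} t \<partial>lborel)"
    proof (intro nn_integral_mono)
      fix t show "h t \<le> ennreal R * indicator {-R..R} t"
        using that(3,4)[of t] by (cases "h t = 0") (auto simp: zero_less_iff_neq_zero)
    qed
    also have "\<dots> = ennreal R * emeasure lborel {-R..R}" by (simp add: nn_integral_cmult)
    also have "\<dots> < \<top>" by (simp add: ennreal_mult_less_top emeasure_lborel_Icc_eq)
    finally obtain F where F: "0 < F" "(\<integral>\<^sup>+t. h t \<partial>lborel) = ennreal F"
      using pos_h by (cases "\<integral>\<^sup>+t. h t \<partial>lborel" rule: ennreal_pos_cases) auto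
    then show ?thesis
      using that(1) by (intro exI[of _ "F / C"]) (simp add: nn_integral_divide divide_ennreal flip: ennreal_mult)
  qed
  obtain c where c: "0 < c" "(\<integral>\<^sup>+t. \<phi>0 t \<partial>lborel) = ennreal (A * c)" "(\<integral>\<^sup>+t. \<psi>0 t \<partial>lborel) = ennreal c"
    using fin[OF A(1) meas(1) bound(1) supp(1) pos(1)] A(1) by (auto simp: \<psi>0_def ennreal_mult)
  obtain d where d: "0 < d" "(\<integral>\<^sup>+t. \<phi>1 t \<partial>lborel) = ennreal (B * d)" "(\<integral>\<^sup>+t. \<psi>1 t \<partial>lborel) = ennreal d"
    using fin[OF B(1) meas(2) bound(2) supp(2) pos(2)] B(1) by (auto simp: \<psi>1_def ennreal_mult)
  have "power_mean (marginal_order s) \<theta> (\<integral>\<^sup>+t. \<phi>0 t \<partial>lborel) (\<integral>\<^sup>+t. \<phi>1 t \<partial>lborel)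
      \<le> m * ennreal (\<theta> * c + (1 - \<theta>) * d)"
    unfolding c d m_def by (rule power_mean_hoelder[OF s \<theta> A(1) B(1) c(1) d(1)])
  also have "\<dots> \<le> m * ((\<integral>\<^sup>+t. \<phi> t \<partial>lborel) / m)"
    using main c d \<theta> by (intro mult_left_mono) (simp_all add: ennreal_mult)
  also have "\<dots> = (\<integral>\<^sup>+t. \<phi> t \<partial>lborel)"
    using m by (simp add: ennreal_times_divide mult.commute[of m] mult_divide_eq_ennreal)
  finally show ?thesis .
qed

text \<open>Truncating \<open>\<phi>0\<close> and \<open>\<phi>1\<close> in height and in width preserves their quasi-concavity and, by monotonicity of the mean,
  the hypothesis relating them to \<open>\<phi>\<close>. Monotone convergence and continuity of the mean remove the
  truncation, also when the integrals are infinite.\<close>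

theorem borell_brascamp_lieb:
  fixes \<phi>0 \<phi>1 \<phi> :: "real \<Rightarrow> ennreal" and s \<theta> :: real
  assumes s: "-1 \<le> s" and \<theta>: "0 < \<theta>" "\<theta> < 1"
    and meas [measurable]: "\<phi>0 \<in> borel_measurable borel" "\<phi>1 \<in> borel_measurable borel" "\<phi> \<in> borel_measurable borel"
    and quasi: "\<And>l. 0 < l \<Longrightarrow> convex {t. l \<le> \<phi>0 t}" "\<And>l. 0 < l \<Longrightarrow> convex {t. l \<le> \<phi>1 t}"
    and mean: "\<And>x y. 0 < \<phi>0 x \<Longrightarrow> 0 < \<phi>1 y \<Longrightarrow>
      power_mean (ereal s) \<theta> (\<phi>0 x) (\<phi>1 y) \<le> \<phi> (\<theta> * x + (1 - \<theta>) * y)"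
    and pos: "0 < (\<integral>\<^sup>+t. \<phi>0 t \<partial>lborel)" "0 < (\<integral>\<^sup>+t. \<phi>1 t \<partial>lborel)"
  shows "power_mean (marginal_order s) \<theta> (\<integral>\<^sup>+t. \<phi>0 t \<partial>lborel) (\<integral>\<^sup>+t. \<phi>1 t \<partial>lborel)
    \<le> (\<integral>\<^sup>+t. \<phi> t \<partial>lborel)"
proof -
  define cut where "cut h n t = min (h t) (ennreal (real n)) * indicator {- real n..real n} t"
    for h :: "real \<Rightarrow> ennreal" and n t
  have cut_le: "cut h n t \<le> h t" "cut h n t \<le> ennreal (real n)" for h n t
    by (auto simp: cut_def indicator_def)
  have cut_supp: "t \<in> {- real n..real n}" if "0 < cut h n t" for h n t
    using that by (cases "t \<in> {- real n..real n}") (simp_all add: cut_def)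
  have cut_quasi: "convex {t. l \<le> cut h n t}" if "0 < l" "\<And>l. 0 < l \<Longrightarrow> convex {t. l \<le> h t}" for l h n
  proof -
    have "{t. l \<le> cut h n t} = (if l \<le> ennreal (real n) then {t. l \<le> h t} \<inter> {- real n..real n} else {})"
      using that(1) by (auto simp: cut_def indicator_def split: if_splits)
    then show ?thesis using that by (simp add: convex_Int)
  qed
  have cut_meas [measurable]: "cut h n \<in> borel_measurable borel" if "h \<in> borel_measurable borel" for h n
    unfolding cut_def using that by measurable
  have lim: "(\<lambda>n. \<integral>\<^sup>+t. cut h n t \<partial>lborel) \<longlonglongrightarrow> (\<integral>\<^sup>+t. h t \<partial>lborel)"
    if "h \<in> borel_measurable borel" for h
  proof (rule nn_integral_LIMSEQ)
    show "incseq (cut h)"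
      unfolding incseq_def le_fun_def cut_def
      by (intro allI impI mult_mono min.mono ennreal_leI) (auto simp: indicator_def)
    fix t
    have "(\<lambda>n. min (h t) (of_nat n)) \<longlonglongrightarrow> min (h t) \<top>"
      by (intro tendsto_min tendsto_const of_nat_tendsto_top_ennreal)
    moreover have "\<forall>\<^sub>F n in sequentially. min (h t) (of_nat n) = cut h n t"
      using eventually_ge_at_top[of "nat \<lceil>\<bar>t\<bar>\<rceil>"]
    proof eventually_elim
      case (elim n)
      then have "t \<in> {- real n..real n}" by (simp add: nat_le_iff ceiling_le_iff) linarith
      then show ?case by (simp add: cut_def ennreal_of_nat_eq_real_of_nat)
    qed
    ultimately show "(\<lambda>n. cut h n t) \<longlonglongrightarrow> h t"
      by (simp add: tendsto_cong)
  qed (use that in measurable)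
  note lim0 = lim[OF meas(1)] and lim1 = lim[OF meas(2)]
  have "\<forall>\<^sub>F n in sequentially. power_mean (marginal_order s) \<theta> (\<integral>\<^sup>+t. cut \<phi>0 n t \<partial>lborel) (\<integral>\<^sup>+t. cut \<phi>1 n t \<partial>lborel)
      \<le> (\<integral>\<^sup>+t. \<phi> t \<partial>lborel)"
    using order_tendstoD(1)[OF lim0 pos(1)] order_tendstoD(1)[OF lim1 pos(2)]
  proof eventually_elim
    case (elim n)
    show ?case
    proof (rule borell_brascamp_lieb_bounded[OF s \<theta>, where R = "real n"])
      fix x y assume "0 < cut \<phi>0 n x" "0 < cut \<phi>1 n y"
      then have "0 < \<phi>0 x" "0 < \<phi>1 y" using cut_le(1) order_less_le_trans by blast+
      moreover have "power_mean (ereal s) \<theta> (cut \<phi>0 n x) (cut \<phi>1 n y) \<le> power_mean (ereal s) \<theta> (\<phi>0 x) (\<phi>1 y)"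
        by (intro power_mean_mono \<theta> cut_le)
      ultimately show "power_mean (ereal s) \<theta> (cut \<phi>0 n x) (cut \<phi>1 n y) \<le> \<phi> (\<theta> * x + (1 - \<theta>) * y)"
        using mean order_trans by blast
    qed (use elim cut_le cut_supp cut_quasi quasi in auto)
  qed
  then show ?thesis
    by (rule tendsto_upperbound[OF tendsto_power_mean[OF \<theta> pos lim0 lim1]]) simp
qed

section \<open>Concave densities\<close>

lemma convexI_open_segment:
  assumes "\<And>x y \<theta>. x \<in> S \<Longrightarrow> y \<in> S \<Longrightarrow> x \<noteq> y \<Longrightarrow> 0 < \<theta> \<Longrightarrow> \<theta> < 1 \<Longrightarrow> \<theta> *\<^sub>R x + (1 - \<theta>) *\<^sub>R y \<in> S"
  shows "convex S"
proof (rule convexI)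
  fix x y and u v :: real
  assume *: "x \<in> S" "y \<in> S" "0 \<le> u" "0 \<le> v" "u + v = 1"
  then have v: "v = 1 - u" by simp
  consider "u = 0" | "u = 1" | "x = y" | "x \<noteq> y" "0 < u" "u < 1" using * by fastforce
  then show "u *\<^sub>R x + v *\<^sub>R y \<in> S"
    using * assms[of x y u] by cases (auto simp: v simp flip: scaleR_add_left)
qed

text \<open>Convexity of the support comes for free, as a mean of positive numbers is positive.\<close>

lemma s_concave_densityI:
  assumes "\<And>x y \<theta>. 0 < g x \<Longrightarrow> 0 < g y \<Longrightarrow> 0 < \<theta> \<Longrightarrow> \<theta> < 1 \<Longrightarrow>
    power_mean s \<theta> (g x) (g y) \<le> g (\<theta> *\<^sub>R x + (1 - \<theta>) *\<^sub>R y)"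
  shows "s_concave_density s g"
proof -
  have "convex {x. 0 < g x}"
    by (rule convexI_open_segment) (use assms power_mean_pos order_less_le_trans in \<open>metis mem_Collect_eq\<close>)
  then show ?thesis using assms by (simp add: s_concave_density_def s_concave_on_def)
qed

lemma s_concave_densityD:
  assumes "s_concave_density s g" "0 < g x" "0 < g y" "0 < \<theta>" "\<theta> < 1"
  shows "power_mean s \<theta> (g x) (g y) \<le> g (\<theta> *\<^sub>R x + (1 - \<theta>) *\<^sub>R y)"
  using assms by (simp add: s_concave_density_def s_concave_on_def)

lemma strictly_s_concave_densityI:
  assumes "\<And>x y \<theta>. 0 < g x \<Longrightarrow> 0 < g y \<Longrightarrow> x \<noteq> y \<Longrightarrow> 0 < \<theta> \<Longrightarrow> \<theta> < 1 \<Longrightarrow>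
    power_mean s \<theta> (g x) (g y) < g (\<theta> *\<^sub>R x + (1 - \<theta>) *\<^sub>R y)"
  shows "strictly_s_concave_density s g"
proof -
  have "convex {x. 0 < g x}"
    by (rule convexI_open_segment) (use assms power_mean_pos order_less_trans in \<open>metis mem_Collect_eq\<close>)
  then show ?thesis using assms by (simp add: strictly_s_concave_density_def strictly_s_concave_on_def)
qed

lemma s_concave_density_cmult:
  assumes k: "0 < k" "k < \<top>" and g: "s_concave_density s g"
  shows "s_concave_density s (\<lambda>x. k * g x)"
proof (rule s_concave_densityI)
  fix x y and \<theta> :: real assume *: "0 < k * g x" "0 < k * g y" and \<theta>: "0 < \<theta>" "\<theta> < 1"
  then have "0 < g x" "0 < g y" by (simp_all add: ennreal_zero_less_mult_iff)
  from s_concave_densityD[OF g this \<theta>]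
  show "power_mean s \<theta> (k * g x) (k * g y) \<le> k * g (\<theta> *\<^sub>R x + (1 - \<theta>) *\<^sub>R y)"
    by (simp add: power_mean_cmult[OF k \<theta>] mult_left_mono)
qed

lemma strictly_s_concave_density_cmult:
  assumes k: "0 < k" "k < \<top>" and g: "strictly_s_concave_density s g"
  shows "strictly_s_concave_density s (\<lambda>x. k * g x)"
proof (rule strictly_s_concave_densityI)
  fix x y and \<theta> :: real assume *: "0 < k * g x" "0 < k * g y" "x \<noteq> y" and \<theta>: "0 < \<theta>" "\<theta> < 1"
  then have "0 < g x" "0 < g y" by (simp_all add: ennreal_zero_less_mult_iff)
  then have "power_mean s \<theta> (g x) (g y) < g (\<theta> *\<^sub>R x + (1 - \<theta>) *\<^sub>R y)"
    using g *(3) \<theta> by (simp add: strictly_s_concave_density_def strictly_s_concave_on_def)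
  then show "power_mean s \<theta> (k * g x) (k * g y) < k * g (\<theta> *\<^sub>R x + (1 - \<theta>) *\<^sub>R y)"
    by (simp add: power_mean_cmult[OF k \<theta>] ennreal_mult_strict_left_mono k)
qed

lemma borel_measurable_antimono_ennreal:
  fixes G :: "real \<Rightarrow> ennreal"
  assumes "antimono G"
  shows "G \<in> borel_measurable borel"
proof (rule borel_measurableI_greater)
  fix y
  have "is_interval {x. y < G x}"
    unfolding is_interval_1 using antimonoD[OF assms] by (auto intro: order_less_le_trans)
  then show "{x \<in> space borel. y < G x} \<in> sets borel"
    using real_interval_borel_measurable by simp
qed

text \<open>Comparisons start at the argument 0, so that the value at the origin is included.\<close>

definition strictly_decreasing_on_support :: "(real \<Rightarrow> ennreal) \<Rightarrow> bool" where
  "strictly_decreasing_on_support G \<longleftrightarrow> (\<forall>x y. 0 \<le> x \<longrightarrow> x < y \<longrightarrow> 0 < G y \<longrightarrow> G y < G x)"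

lemma s_concave_antimono_comp:
  fixes q :: "'a::real_vector \<Rightarrow> real"
  assumes G: "antimono G" "s_concave_density s G"
    and q: "\<And>x y \<theta>. 0 < \<theta> \<Longrightarrow> \<theta> < 1 \<Longrightarrow> q (\<theta> *\<^sub>R x + (1 - \<theta>) *\<^sub>R y) \<le> \<theta> * q x + (1 - \<theta>) * q y"
  shows "s_concave_density s (\<lambda>v. G (q v))"
proof (rule s_concave_densityI)
  fix x y and \<theta> :: real
  assume pos: "0 < G (q x)" "0 < G (q y)" and \<theta>: "0 < \<theta>" "\<theta> < 1"
  have "power_mean s \<theta> (G (q x)) (G (q y)) \<le> G (\<theta> * q x + (1 - \<theta>) * q y)"
    using s_concave_densityD[OF G(2) pos \<theta>] by simp
  also have "\<dots> \<le> G (q (\<theta> *\<^sub>R x + (1 - \<theta>) *\<^sub>R y))"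
    by (intro antimonoD[OF G(1)] q \<theta>)
  finally show "power_mean s \<theta> (G (q x)) (G (q y)) \<le> G (q (\<theta> *\<^sub>R x + (1 - \<theta>) *\<^sub>R y))" .
qed

text \<open>The strict decrease of \<open>G\<close> is applied at the argument \<open>\<theta> q(x) + (1 - \<theta>) q(y)\<close>, which lies in
  the support since the mean there is positive.\<close>

lemma strictly_s_concave_antimono_comp:
  fixes q :: "'a::real_vector \<Rightarrow> real"
  assumes G: "antimono G" "s_concave_density s G" "strictly_decreasing_on_support G"
    and q: "\<And>x y \<theta>. x \<noteq> y \<Longrightarrow> 0 < \<theta> \<Longrightarrow> \<theta> < 1 \<Longrightarrow> q (\<theta> *\<^sub>R x + (1 - \<theta>) *\<^sub>R y) < \<theta> * q x + (1 - \<theta>) * q y"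
    and q0: "\<And>x. 0 \<le> q x"
  shows "strictly_s_concave_density s (\<lambda>v. G (q v))"
proof (rule strictly_s_concave_densityI)
  fix x y and \<theta> :: real
  assume pos: "0 < G (q x)" "0 < G (q y)" and xy: "x \<noteq> y" and \<theta>: "0 < \<theta>" "\<theta> < 1"
  have le: "power_mean s \<theta> (G (q x)) (G (q y)) \<le> G (\<theta> * q x + (1 - \<theta>) * q y)"
    using s_concave_densityD[OF G(2) pos \<theta>] by simp
  moreover have "\<dots> < G (q (\<theta> *\<^sub>R x + (1 - \<theta>) *\<^sub>R y))"
    using G(3) q[OF xy \<theta>] q0 order_less_le_trans[OF power_mean_pos[OF \<theta> pos] le]
    by (simp add: strictly_decreasing_on_support_def)
  ultimately show "power_mean s \<theta> (G (q x)) (G (q y)) < G (q (\<theta> *\<^sub>R x + (1 - \<theta>) *\<^sub>R y))"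
    by (rule order_le_less_trans)
qed

section \<open>Integrals of a generator along parabolas\<close>

text \<open>The integral over \<open>J\<close> of a density along a line on which the quadratic form is \<open>\<alpha> (t - c)\<^sup>2 + r\<close>.\<close>

definition slice_integral :: "(real \<Rightarrow> ennreal) \<Rightarrow> real \<Rightarrow> real set \<Rightarrow> real \<Rightarrow> real \<Rightarrow> ennreal" where
  "slice_integral G \<alpha> J c r = (\<integral>\<^sup>+t\<in>J. G (\<alpha> * (t - c)\<^sup>2 + r) \<partial>lborel)"

lemma slice_integral_antimono:
  assumes "antimono G" "r \<le> r'"
  shows "slice_integral G \<alpha> J c r' \<le> slice_integral G \<alpha> J c r"
  unfolding slice_integral_def
  using assms by (intro nn_integral_mono mult_right_mono) (auto intro: antimonoD)

lemma weighted_square_le: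
  fixes u w \<theta> :: real
  assumes "0 \<le> \<theta>" "\<theta> \<le> 1"
  shows "(\<theta> * u + (1 - \<theta>) * w)\<^sup>2 \<le> \<theta> * u\<^sup>2 + (1 - \<theta>) * w\<^sup>2"
proof -
  have "\<theta> * u\<^sup>2 + (1 - \<theta>) * w\<^sup>2 - (\<theta> * u + (1 - \<theta>) * w)\<^sup>2 = \<theta> * (1 - \<theta>) * (u - w)\<^sup>2"
    by (simp add: power2_eq_square algebra_simps)
  moreover have "0 \<le> \<theta> * (1 - \<theta>) * (u - w)\<^sup>2" using assms by simp
  ultimately show ?thesis by linarith
qed

text \<open>Concavity jointly in the centre and the offset, which is stronger than concavity along any one
  convex choice of offsets and leaves room for a strict gain in the offset.\<close>

lemma slice_integral_power_mean:
  assumes G: "antimono G" "s_concave_density (ereal s) G" and s: "-1 \<le> s" and \<alpha>: "0 \<le> \<alpha>"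
    and J: "convex J" "J \<in> sets borel" and \<theta>: "0 < \<theta>" "\<theta> < 1"
    and pos: "0 < slice_integral G \<alpha> J c0 r0" "0 < slice_integral G \<alpha> J c1 r1"
  shows "power_mean (marginal_order s) \<theta> (slice_integral G \<alpha> J c0 r0) (slice_integral G \<alpha> J c1 r1)
    \<le> slice_integral G \<alpha> J (\<theta> * c0 + (1 - \<theta>) * c1) (\<theta> * r0 + (1 - \<theta>) * r1)"
proof -
  let ?h = "\<lambda>c r t. G (\<alpha> * (t - c)\<^sup>2 + r) * indicator J t"
  have convex_arg: "\<alpha> * (\<theta>' * x + (1 - \<theta>') * y - (\<theta>' * c + (1 - \<theta>') * c'))\<^sup>2 + (\<theta>' * r + (1 - \<theta>') * r')
      \<le> \<theta>' * (\<alpha> * (x - c)\<^sup>2 + r) + (1 - \<theta>') * (\<alpha> * (y - c')\<^sup>2 + r')"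
    if "0 \<le> \<theta>'" "\<theta>' \<le> 1" for \<theta>' x y c c' r r'
  proof -
    have "\<alpha> * (\<theta>' * (x - c) + (1 - \<theta>') * (y - c'))\<^sup>2 \<le> \<alpha> * (\<theta>' * (x - c)\<^sup>2 + (1 - \<theta>') * (y - c')\<^sup>2)"
      by (intro mult_left_mono weighted_square_le \<alpha> that)
    moreover have "\<theta>' * x + (1 - \<theta>') * y - (\<theta>' * c + (1 - \<theta>') * c') = \<theta>' * (x - c) + (1 - \<theta>') * (y - c')"
      by (simp add: algebra_simps)
    ultimately show ?thesis by (simp add: algebra_simps)
  qed
  have quasi: "convex {t. l \<le> ?h c r t}" if "0 < l" for l c r
  proof -
    have "{t. l \<le> ?h c r t} = J \<inter> {t. l \<le> G (\<alpha> * (t - c)\<^sup>2 + r)}"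
      using that by (auto simp: indicator_def split: if_splits)
    moreover have "convex {t. l \<le> G (\<alpha> * (t - c)\<^sup>2 + r)}"
    proof (rule convexI_open_segment)
      fix x y t :: real
      assume *: "x \<in> {t. l \<le> G (\<alpha> * (t - c)\<^sup>2 + r)}" "y \<in> {t. l \<le> G (\<alpha> * (t - c)\<^sup>2 + r)}" "0 < t" "t < 1"
      have "\<alpha> * (t * x + (1 - t) * y - c)\<^sup>2 + r \<le> t * (\<alpha> * (x - c)\<^sup>2 + r) + (1 - t) * (\<alpha> * (y - c)\<^sup>2 + r)"
        using convex_arg[of t x y c c r r] * by (simp add: algebra_simps)
      also have "\<dots> \<le> max (\<alpha> * (x - c)\<^sup>2 + r) (\<alpha> * (y - c)\<^sup>2 + r)"
        using * by (intro convex_bound_le) auto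
      finally have "G (max (\<alpha> * (x - c)\<^sup>2 + r) (\<alpha> * (y - c)\<^sup>2 + r)) \<le> G (\<alpha> * (t * x + (1 - t) * y - c)\<^sup>2 + r)"
        by (rule antimonoD[OF G(1)])
      moreover have "l \<le> G (max (\<alpha> * (x - c)\<^sup>2 + r) (\<alpha> * (y - c)\<^sup>2 + r))"
        using * by (simp add: max_def)
      ultimately show "t *\<^sub>R x + (1 - t) *\<^sub>R y \<in> {t. l \<le> G (\<alpha> * (t - c)\<^sup>2 + r)}"
        by simp
    qed
    ultimately show ?thesis using J by (simp add: convex_Int)
  qed
  note [measurable] = borel_measurable_antimono_ennreal[OF G(1)] J(2)
  show ?thesis
    using pos unfolding slice_integral_def
  proof (intro borell_brascamp_lieb[OF s \<theta>])
    fix x y assume *: "0 < ?h c0 r0 x" "0 < ?h c1 r1 y"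
    then have xy: "x \<in> J" "y \<in> J" "0 < G (\<alpha> * (x - c0)\<^sup>2 + r0)" "0 < G (\<alpha> * (y - c1)\<^sup>2 + r1)"
      by (cases "x \<in> J"; cases "y \<in> J"; simp)+
    have "\<theta> * x + (1 - \<theta>) * y \<in> J"
      using convexD[OF J(1) xy(1,2), of \<theta> "1 - \<theta>"] \<theta> by simp
    moreover have "power_mean (ereal s) \<theta> (G (\<alpha> * (x - c0)\<^sup>2 + r0)) (G (\<alpha> * (y - c1)\<^sup>2 + r1))
        \<le> G (\<theta> * (\<alpha> * (x - c0)\<^sup>2 + r0) + (1 - \<theta>) * (\<alpha> * (y - c1)\<^sup>2 + r1))"
      using s_concave_densityD[OF G(2) xy(3,4) \<theta>] by simp
    moreover have "\<dots> \<le> G (\<alpha> * (\<theta> * x + (1 - \<theta>) * y - (\<theta> * c0 + (1 - \<theta>) * c1))\<^sup>2 + (\<theta> * r0 + (1 - \<theta>) * r1))"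
      using \<theta> by (intro antimonoD[OF G(1)] convex_arg) auto
    ultimately show "power_mean (ereal s) \<theta> (?h c0 r0 x) (?h c1 r1 y)
        \<le> ?h (\<theta> * c0 + (1 - \<theta>) * c1) (\<theta> * r0 + (1 - \<theta>) * r1) (\<theta> * x + (1 - \<theta>) * y)"
      using xy by (auto intro: order_trans)
  qed (use quasi in auto)
qed

text \<open>If \<open>G\<close> decreases strictly, the integrand grows at every point of \<open>J\<close> where it was positive. If the support is
  bounded, the set of \<open>t\<close> where the integrand is positive grows to the right; as \<open>J\<close> is closed upwards,
  it contains the gained interval.\<close>

lemma slice_integral_strict_antimono:
  assumes G: "antimono G" and \<alpha>: "0 < \<alpha>" and r: "0 \<le> r" "r < r'"
    and J: "J \<in> sets borel" "\<And>t t'. t \<in> J \<Longrightarrow> t < t' \<Longrightarrow> t' \<in> J"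
    and pos: "0 < slice_integral G \<alpha> J c r'" and fin: "slice_integral G \<alpha> J c r' < \<top>"
    and strict: "strictly_decreasing_on_support G \<or> bdd_above {x. 0 < G x}"
  shows "slice_integral G \<alpha> J c r' < slice_integral G \<alpha> J c r"
proof -
  note [measurable] = borel_measurable_antimono_ennreal[OF G] J(1)
  let ?h = "\<lambda>r t. G (\<alpha> * (t - c)\<^sup>2 + r) * indicator J t"
  have nonnull: "\<not> (AE t in lborel. ?h r' t = 0)"
    using pos by (simp add: slice_integral_def nn_integral_0_iff_AE zero_less_iff_neq_zero)
  have "\<not> (AE t in lborel. ?h r t \<le> ?h r' t)"
  proof
    assume AE: "AE t in lborel. ?h r t \<le> ?h r' t"
    from strict show False
    proof
      assume dec: "strictly_decreasing_on_support G"
      from AE have "AE t in lborel. ?h r' t = 0"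
      proof eventually_elim
        case (elim t)
        show ?case
        proof (rule ccontr)
          assume "?h r' t \<noteq> 0"
          then have t: "t \<in> J" "0 < G (\<alpha> * (t - c)\<^sup>2 + r')"
            by (auto simp: indicator_def zero_less_iff_neq_zero split: if_splits)
          have "0 \<le> \<alpha> * (t - c)\<^sup>2 + r" using \<alpha> r by simp
          with dec t r have "G (\<alpha> * (t - c)\<^sup>2 + r') < G (\<alpha> * (t - c)\<^sup>2 + r)"
            by (simp add: strictly_decreasing_on_support_def)
          then show False using elim t by (simp add: not_less[symmetric])
        qed
      qed
      with nonnull show False by blast
    next
      assume bdd: "bdd_above {x. 0 < G x}"
      obtain t where t: "t \<in> J" "0 < G (\<alpha> * (t - c)\<^sup>2 + r')"
      proof (rule ccontr)
        assume "\<not> thesis"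
        then have "?h r' t = 0" for t using that by (auto simp: indicator_def zero_less_iff_neq_zero)
        then show False using nonnull by simp
      qed
      define b where "b = Sup {x. 0 < G x}"
      have b: "x \<le> b" if "0 < G x" for x using that bdd by (auto simp: b_def intro: cSup_upper)
      have b': "0 < G x" if xb: "x < b" for x
      proof -
        obtain y where "0 < G y" "x < y"
          using less_cSupD[of "{x. 0 < G x}" x] xb t(2) unfolding b_def by blast
        then show ?thesis using antimonoD[OF G, of x y] by (simp add: order_less_le_trans)
      qed
      \<comment> \<open>At \<open>w\<close> the slice at height \<open>r'\<close> leaves the support; just beyond it the lower slice has not left.\<close>
      define w where "w = c + sqrt ((b - r') / \<alpha>)"
      define w' where "w' = c + sqrt ((b - r) / \<alpha>)"
      have br: "r' \<le> b" using b[OF t(2)] \<alpha> by (smt (verit) zero_le_mult_iff zero_le_power2)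
      have ww: "w < w'" using r \<alpha> by (simp add: w_def w'_def divide_strict_right_mono)
      have "(t - c)\<^sup>2 \<le> (b - r') / \<alpha>" using b[OF t(2)] \<alpha> by (simp add: pos_le_divide_eq mult.commute)
      then have "t - c \<le> sqrt ((b - r') / \<alpha>)" by (metis real_le_rsqrt)
      then have tw: "t \<le> w" by (simp add: w_def)
      have "\<not> (?h r u \<le> ?h r' u)" if "u \<in> {w<..<w'}" for u
      proof -
        have u: "sqrt ((b - r') / \<alpha>) < u - c" "u - c < sqrt ((b - r) / \<alpha>)" using that by (auto simp: w_def w'_def)
        have nn: "0 \<le> (b - r') / \<alpha>" "0 \<le> (b - r) / \<alpha>" using br r \<alpha> by auto
        have uc: "0 \<le> u - c" using u(1) nn(1) real_sqrt_ge_zero[OF nn(1)] by linarith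
        have "(b - r') / \<alpha> < (u - c)\<^sup>2" "(u - c)\<^sup>2 < (b - r) / \<alpha>"
          using u uc nn power_strict_mono[OF u(1), of 2] power_strict_mono[OF u(2), of 2] by simp_all
        then have "b < \<alpha> * (u - c)\<^sup>2 + r'" "\<alpha> * (u - c)\<^sup>2 + r < b"
          using \<alpha> by (simp_all add: field_simps)
        then have "G (\<alpha> * (u - c)\<^sup>2 + r') = 0" "0 < G (\<alpha> * (u - c)\<^sup>2 + r)"
          using b b' by (auto simp: zero_less_iff_neq_zero not_le[symmetric])
        moreover have "u \<in> J" using J(2)[OF t(1)] tw that by simp
        ultimately show ?thesis by simp
      qed
      then have "AE u in lborel. u \<notin> {w<..<w'}" using AE by (auto elim!: eventually_mono)
      then have "emeasure lborel {w<..<w'} = 0" by (subst (asm) AE_iff_measurable[where N = "{w<..<w'}"]) auto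
      then show False using ww by simp
    qed
  qed
  moreover have "AE t in lborel. ?h r' t \<le> ?h r t"
    using G r by (auto intro!: AE_I2 mult_right_mono antimonoD[OF G])
  ultimately show ?thesis
    unfolding slice_integral_def using fin by (intro nn_integral_less) (auto simp: slice_integral_def)
qed

text \<open>Stated for an arbitrary convex range \<open>J\<close> of the integrated coordinate, so that the whole line gives the marginal
  density and the positive half-line the skew-elliptical one.\<close>

lemma s_concave_slice_integral:
  fixes l q :: "'a::real_vector \<Rightarrow> real"
  assumes G: "antimono G" "s_concave_density (ereal s) G" and s: "-1 \<le> s" and \<alpha>: "0 < \<alpha>"
    and J: "convex J" "J \<in> sets borel"
    and l: "linear l"
    and q: "\<And>x y \<theta>. 0 < \<theta> \<Longrightarrow> \<theta> < 1 \<Longrightarrow> q (\<theta> *\<^sub>R x + (1 - \<theta>) *\<^sub>R y) \<le> \<theta> * q x + (1 - \<theta>) * q y"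
  shows "s_concave_density (marginal_order s) (\<lambda>v. slice_integral G \<alpha> J (l v) (q v))"
proof (rule s_concave_densityI)
  fix x y and \<theta> :: real
  assume pos: "0 < slice_integral G \<alpha> J (l x) (q x)" "0 < slice_integral G \<alpha> J (l y) (q y)" and \<theta>: "0 < \<theta>" "\<theta> < 1"
  have "power_mean (marginal_order s) \<theta> (slice_integral G \<alpha> J (l x) (q x)) (slice_integral G \<alpha> J (l y) (q y))
      \<le> slice_integral G \<alpha> J (l (\<theta> *\<^sub>R x + (1 - \<theta>) *\<^sub>R y)) (\<theta> * q x + (1 - \<theta>) * q y)"
    using slice_integral_power_mean[OF G s less_imp_le[OF \<alpha>] J \<theta> pos]
    by (simp add: linear_add[OF l] linear_scale[OF l])
  also have "\<dots> \<le> slice_integral G \<alpha> J (l (\<theta> *\<^sub>R x + (1 - \<theta>) *\<^sub>R y)) (q (\<theta> *\<^sub>R x + (1 - \<theta>) *\<^sub>R y))"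
    by (intro slice_integral_antimono G q \<theta>)
  finally show "power_mean (marginal_order s) \<theta> (slice_integral G \<alpha> J (l x) (q x)) (slice_integral G \<alpha> J (l y) (q y))
      \<le> slice_integral G \<alpha> J (l (\<theta> *\<^sub>R x + (1 - \<theta>) *\<^sub>R y)) (q (\<theta> *\<^sub>R x + (1 - \<theta>) *\<^sub>R y))" .
qed

text \<open>A strict decrease of the integrand gives one of the integral only if the integral is finite, and at offset 0 it may
  be infinite. The offset \<open>\<theta> q(x) + (1 - \<theta>) q(y)\<close> is positive, because it exceeds
  \<open>q(\<theta> x + (1 - \<theta>) y) \<ge> 0\<close>.\<close>

lemma strictly_s_concave_slice_integral:
  fixes l q :: "'a::real_vector \<Rightarrow> real"
  assumes G: "antimono G" "s_concave_density (ereal s) G" and s: "-1 \<le> s" and \<alpha>: "0 < \<alpha>"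
    and J: "convex J" "J \<in> sets borel" "\<And>t t'. t \<in> J \<Longrightarrow> t < t' \<Longrightarrow> t' \<in> J"
    and l: "linear l"
    and q: "\<And>x y \<theta>. x \<noteq> y \<Longrightarrow> 0 < \<theta> \<Longrightarrow> \<theta> < 1 \<Longrightarrow> q (\<theta> *\<^sub>R x + (1 - \<theta>) *\<^sub>R y) < \<theta> * q x + (1 - \<theta>) * q y"
    and q0: "\<And>x. 0 \<le> q x"
    and fin: "\<And>c r. 0 < r \<Longrightarrow> slice_integral G \<alpha> J c r < \<top>"
    and strict: "strictly_decreasing_on_support G \<or> bdd_above {x. 0 < G x}"
  shows "strictly_s_concave_density (marginal_order s) (\<lambda>v. slice_integral G \<alpha> J (l v) (q v))"
proof (rule strictly_s_concave_densityI)
  fix x y and \<theta> :: real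
  assume pos: "0 < slice_integral G \<alpha> J (l x) (q x)" "0 < slice_integral G \<alpha> J (l y) (q y)"
    and xy: "x \<noteq> y" and \<theta>: "0 < \<theta>" "\<theta> < 1"
  let ?z = "\<theta> *\<^sub>R x + (1 - \<theta>) *\<^sub>R y" and ?r = "\<theta> * q x + (1 - \<theta>) * q y"
  have le: "power_mean (marginal_order s) \<theta> (slice_integral G \<alpha> J (l x) (q x)) (slice_integral G \<alpha> J (l y) (q y))
      \<le> slice_integral G \<alpha> J (l ?z) ?r"
    using slice_integral_power_mean[OF G s less_imp_le[OF \<alpha>] J(1,2) \<theta> pos]
    by (simp add: linear_add[OF l] linear_scale[OF l])
  have pos': "0 < slice_integral G \<alpha> J (l ?z) ?r"
    using power_mean_pos[OF \<theta> pos] le by (rule order_less_le_trans)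
  have less: "q ?z < ?r" by (intro q xy \<theta>)
  with q0[of ?z] have "0 < ?r" by linarith
  have "slice_integral G \<alpha> J (l ?z) ?r < slice_integral G \<alpha> J (l ?z) (q ?z)"
  proof (rule slice_integral_strict_antimono[OF G(1) \<alpha> q0 less J(2) _ pos' fin[OF \<open>0 < ?r\<close>] strict])
    show "t' \<in> J" if "t \<in> J" "t < t'" for t t' by (rule J(3)[OF that])
  qed
  with le show "power_mean (marginal_order s) \<theta> (slice_integral G \<alpha> J (l x) (q x)) (slice_integral G \<alpha> J (l y) (q y))
      < slice_integral G \<alpha> J (l ?z) (q ?z)" by (rule order_le_less_trans)
qed

section \<open>Modes and the monotonicity of generators\<close>

text \<open>The modes are symmetric about the origin, which is therefore the midpoint of two of them.\<close>

lemma zero_mode_if_even: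
  fixes g :: "'a::real_normed_vector \<Rightarrow> ennreal"
  assumes "c_unimodal g" and even: "\<And>x. g (- x) = g x"
  shows "0 \<in> modes g"
proof -
  obtain m where m: "m \<in> modes g" and conv: "convex (modes g)"
    using assms(1) by (auto simp: c_unimodal_def)
  have "filterlim (\<lambda>x::'a. - x) (nhds m) (nhds (- m))"
    using tendsto_minus[OF filterlim_ident, of "- m"] by simp
  with m have "\<forall>\<^sub>F x in nhds (- m). g (- x) \<le> g m"
    unfolding modes_def by (auto dest: eventually_compose_filterlim)
  with m have "- m \<in> modes g" by (simp add: modes_def even)
  then have "(1 / 2) *\<^sub>R m + (1 / 2) *\<^sub>R (- m) \<in> modes g"
    using m by (intro convexD[OF conv]) auto
  then show ?thesis by simp
qed

lemma s_concave_generatorD: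
  assumes "s_concave_generator s f" "0 < x" "0 < y" "0 < f x" "0 < f y" "0 < \<theta>" "\<theta> < 1"
  shows "power_mean s \<theta> (ennreal (f x)) (ennreal (f y)) \<le> ennreal (f (\<theta> * x + (1 - \<theta>) * y))"
  using assms by (simp add: s_concave_generator_def s_concave_on_def gen_support_def)

lemma gen_support_connected:
  assumes "s_concave_generator s f" "0 < x" "0 < f x" "0 < f z" "x \<le> y" "y \<le> z"
  shows "0 < f y"
proof -
  have int: "is_interval (gen_support f)"
    using assms(1) by (simp add: s_concave_generator_def s_concave_on_def is_interval_convex_1)
  have "x \<in> gen_support f" "z \<in> gen_support f"
    using assms by (simp_all add: gen_support_def)
  then have "y \<in> gen_support f"
    by (rule mem_is_interval_1_I[OF int _ _ assms(5,6)])
  then show ?thesis by (simp add: gen_support_def)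
qed

lemma between_convex_combination:
  fixes t x y :: real
  assumes "t < x" "x < y"
  obtains \<theta> where "0 < \<theta>" "\<theta> < 1" "x = \<theta> * t + (1 - \<theta>) * y"
proof
  show "0 < (y - x) / (y - t)" "(y - x) / (y - t) < 1" using assms by (auto simp: divide_simps)
  have "u * t + (1 - u) * y = y - u * (y - t)" for u :: real
    by (simp add: algebra_simps)
  from this[of "(y - x) / (y - t)"] show "x = (y - x) / (y - t) * t + (1 - (y - x) / (y - t)) * y" using assms by simp
qed

text \<open>If \<open>f v < f w\<close> with \<open>v < w\<close>, then \<open>f t < f v\<close> for every \<open>t < v\<close>, since otherwise
  \<open>f v\<close> would be less than the mean of \<open>f t\<close> and \<open>f w\<close>. Repeating the argument, \<open>f\<close> is strictly increasing
  up to \<open>v\<close>, and its limit at 0 is below nearby values, against the local maximum. Finiteness of \<open>s\<close>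
  matters: a quasi-concave function may be constant near 0 and increase later.\<close>

lemma generator_antimono:
  fixes f :: "real \<Rightarrow> real" and s :: real
  assumes f: "s_concave_generator (ereal s) f" "\<And>x. 0 < x \<Longrightarrow> 0 \<le> f x"
    and L: "0 < gen_ext f 0" "\<forall>\<^sub>F x in at_right 0. gen_ext f x \<le> gen_ext f 0"
  shows "antimono_on {0<..} f"
proof (rule monotone_onI, rule ccontr)
  fix x y assume "x \<in> {0<..}" "x \<le> y" and "\<not> f y \<le> f x"
  then have xy: "0 < x" "x \<le> y" by auto
  assume "\<not> f y \<le> f x"
  then have less: "f x < f y" "x < y" using xy by (auto simp: order_less_le)
  have L_eq: "gen_ext f 0 = Limsup (at_right 0) (\<lambda>t. ennreal (f t))" by (simp add: gen_ext_def)
  have near: "\<exists>t. 0 < t \<and> t < b \<and> 0 < f t" if "0 < b" for b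
  proof (rule ccontr)
    assume "\<not> ?thesis"
    then have "ennreal (f t) \<le> 0" if "0 < t" "t < b" for t
      using that by (metis ennreal_neg not_less order_refl)
    then have "\<forall>\<^sub>F t in at_right 0. ennreal (f t) \<le> 0"
      unfolding eventually_at_right_field using that by blast
    then have "gen_ext f 0 \<le> 0" unfolding L_eq by (rule Limsup_bounded)
    then show False using L(1) by simp
  qed
  have pos: "0 < f v" if "0 < v" "v \<le> w" "0 < f w" for v w
    using near[OF that(1)] gen_support_connected[OF f(1) _ _ that(3) _ that(2)] by force
  have step: "f t < f v" if t: "0 < t" "t < v" "v < w" and vw: "f v < f w" for t v w
  proof (rule ccontr)
    assume "\<not> f t < f v"
    moreover have w: "0 < f w" using vw f(2)[of v] t by simp
    moreover have v: "0 < f v" using pos[of v w] t w by simp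
    ultimately have "0 < f t" "f v \<le> f t" by auto
    obtain \<theta> where \<theta>: "0 < \<theta>" "\<theta> < 1" "v = \<theta> * t + (1 - \<theta>) * w"
      using between_convex_combination t by metis
    have "ennreal (f v) < power_mean (ereal s) \<theta> (ennreal (f t)) (ennreal (f w))"
      using \<theta> v vw \<open>f v \<le> f t\<close> by (intro less_power_mean) (auto intro: ennreal_leI simp: ennreal_lessI)
    also have "\<dots> \<le> ennreal (f v)"
      using s_concave_generatorD[OF f(1), of t w \<theta>] t w \<open>0 < f t\<close> \<theta> by simp
    finally show False by simp
  qed
  have incr: "f t < f v" if "0 < t" "t < v" "v \<le> x" for t v
  proof (cases "v = x")
    case True
    then show ?thesis using step[of t x y] that less by simp
  next
    case False
    then have "f v < f x" using step[of v x y] that less by simp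
    then show ?thesis using step[of t v x] that False by simp
  qed
  obtain b where b: "0 < b" "\<And>t. 0 < t \<Longrightarrow> t < b \<Longrightarrow> gen_ext f t \<le> gen_ext f 0"
    using L(2) by (auto simp: eventually_at_right_field)
  define v where "v = min x (b / 2)"
  have v: "0 < v" "v \<le> x" "v < b" using b xy by (auto simp: v_def)
  have le: "ennreal (f t) \<le> ennreal (f (v / 2))" if "0 < t" "t < v / 2" for t
    using incr[of t "v / 2"] that v by (intro ennreal_leI) simp
  have "\<forall>\<^sub>F t in at_right 0. ennreal (f t) \<le> ennreal (f (v / 2))"
    unfolding eventually_at_right_field
    using v by (intro exI[of _ "v / 2"] conjI allI impI le) simp_all
  then have "gen_ext f 0 \<le> ennreal (f (v / 2))" unfolding L_eq by (rule Limsup_bounded)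
  also have "\<dots> < ennreal (f v)"
    using incr[of "v / 2" v] v f(2)[of "v / 2"] by (simp add: ennreal_less_iff)
  also have "\<dots> \<le> gen_ext f 0" using b(2)[of v] v by (simp add: gen_ext_def)
  finally show False by simp
qed

text \<open>The extension is constant on the non-positive half-line, so monotonicity on the positive half-line extends to the
  whole real line; each value of the generator is at most its values near 0, hence at most the limit superior there.\<close>

lemma antimono_gen_ext:
  assumes f: "antimono_on {0<..} f"
  shows "antimono (gen_ext f)"
proof (rule antimonoI)
  fix x y :: real assume "x \<le> y"
  have "ennreal (f y) \<le> Limsup (at_right 0) (\<lambda>t. ennreal (f t))" if "0 < y"
  proof (rule le_Limsup)
    show "\<forall>\<^sub>F t in at_right 0. ennreal (f y) \<le> ennreal (f t)"
      using that by (auto simp: eventually_at_right_field intro!: exI[of _ y] ennreal_leI monotone_onD[OF f])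
  qed simp
  then show "gen_ext f y \<le> gen_ext f x"
    using monotone_onD[OF f, of x y] \<open>x \<le> y\<close> by (auto simp: gen_ext_def intro!: ennreal_leI)
qed

text \<open>Replacing an argument by its maximum with \<open>e > 0\<close> approaches the value at 0 through positive arguments
  and does nothing to positive ones for small \<open>e\<close>; thus one limit covers every argument.\<close>

lemma tendsto_gen_ext_max:
  assumes f: "antimono_on {0<..} f"
  shows "((\<lambda>e. gen_ext f (max x e)) \<longlongrightarrow> gen_ext f x) (at_right 0)"
proof (cases "0 < x")
  case True
  then have "\<forall>\<^sub>F e in at_right 0. gen_ext f x = gen_ext f (max x e)"
    unfolding eventually_at_right_field by (auto intro!: exI[of _ x] simp: max_def)
  then show ?thesis by (rule Lim_transform_eventually[OF tendsto_const])
next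
  case False
  note anti = antimonoD[OF antimono_gen_ext[OF f]]
  have x: "gen_ext f x = gen_ext f 0" using False by (simp add: gen_ext_def)
  have lim: "(gen_ext f \<longlongrightarrow> gen_ext f 0) (at_right 0)"
  proof (rule order_tendstoI)
    fix a assume a: "a < gen_ext f 0"
    have "\<exists>t0>0. a < gen_ext f t0"
    proof (rule ccontr)
      assume "\<not> ?thesis"
      then have "gen_ext f t \<le> a" if "0 < t" for t using that by (meson not_less)
      then have "\<forall>\<^sub>F t in at_right 0. ennreal (f t) \<le> a"
        unfolding eventually_at_right_field by (intro exI[of _ 1]) (simp add: gen_ext_def)
      then have "Limsup (at_right 0) (\<lambda>t. ennreal (f t)) \<le> a" by (rule Limsup_bounded)
      then show False using a by (simp add: gen_ext_def)
    qed
    then obtain t0 where t0: "0 < t0" "a < gen_ext f t0" by blast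
    have "a < gen_ext f t" if "t < t0" for t
      using t0(2) anti[of t t0] that by simp
    then show "\<forall>\<^sub>F t in at_right 0. a < gen_ext f t"
      unfolding eventually_at_right_field using t0(1) by blast
  next
    fix a assume a: "gen_ext f 0 < a"
    have "gen_ext f t < a" if "0 < t" for t
      using a anti[of 0 t] that by simp
    then show "\<forall>\<^sub>F t in at_right 0. gen_ext f t < a"
      unfolding eventually_at_right_field using zero_less_one by blast
  qed
  have "\<forall>\<^sub>F e in at_right 0. gen_ext f e = gen_ext f (max x e)"
    unfolding eventually_at_right_field using False by (auto intro!: exI[of _ 1] simp: max_def)
  with lim show ?thesis unfolding x by (rule Lim_transform_eventually)
qed

text \<open>The inequality extends from positive arguments to 0 by a limit. Only the means pass to the limit; the
  value at the convex combination is bounded from below by monotonicity.\<close>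

lemma s_concave_gen_ext:
  assumes f: "antimono_on {0<..} f" and s: "s_concave_generator s f"
  shows "s_concave_density s (gen_ext f)"
proof (rule s_concave_densityI)
  fix x y \<theta> :: real
  assume pos: "0 < gen_ext f x" "0 < gen_ext f y" and \<theta>: "0 < \<theta>" "\<theta> < 1"
  have lim: "((\<lambda>e. gen_ext f (max x e)) \<longlongrightarrow> gen_ext f x) (at_right 0)"
    "((\<lambda>e. gen_ext f (max y e)) \<longlongrightarrow> gen_ext f y) (at_right 0)"
    by (rule tendsto_gen_ext_max[OF f])+
  have "\<forall>\<^sub>F e in at_right 0. power_mean s \<theta> (gen_ext f (max x e)) (gen_ext f (max y e))
      \<le> gen_ext f (\<theta> *\<^sub>R x + (1 - \<theta>) *\<^sub>R y)"
    using order_tendstoD(1)[OF lim(1) pos(1)] order_tendstoD(1)[OF lim(2) pos(2)] eventually_at_right_less[of 0]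
  proof eventually_elim
    case (elim e)
    let ?x = "max x e" and ?y = "max y e"
    have xy: "0 < ?x" "0 < ?y" using elim(3) by (auto simp: less_max_iff_disj)
    then have mid: "0 < \<theta> * ?x + (1 - \<theta>) * ?y" using \<theta> by (intro add_pos_pos mult_pos_pos) auto
    have "power_mean s \<theta> (gen_ext f ?x) (gen_ext f ?y) \<le> gen_ext f (\<theta> * ?x + (1 - \<theta>) * ?y)"
      using s_concave_generatorD[OF s xy] elim(1,2) \<theta> xy mid by (simp add: gen_ext_def)
    also have "\<dots> \<le> gen_ext f (\<theta> *\<^sub>R x + (1 - \<theta>) *\<^sub>R y)"
      using \<theta> by (intro antimonoD[OF antimono_gen_ext[OF f]]) (auto intro!: add_mono mult_left_mono)
    finally show ?case .
  qed
  then show "power_mean s \<theta> (gen_ext f x) (gen_ext f y) \<le> gen_ext f (\<theta> *\<^sub>R x + (1 - \<theta>) *\<^sub>R y)"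
    by (rule tendsto_upperbound[OF tendsto_power_mean[OF \<theta> pos lim]]) simp
qed

lemma strictly_decreasing_gen_ext:
  assumes f: "antimono_on {0<..} f"
    and neq: "\<And>x y. 0 < x \<Longrightarrow> x < y \<Longrightarrow> 0 < f y \<Longrightarrow> f x \<noteq> f y"
  shows "strictly_decreasing_on_support (gen_ext f)"
  unfolding strictly_decreasing_on_support_def
proof (intro allI impI)
  fix x y :: real assume xy: "0 \<le> x" "x < y" "0 < gen_ext f y"
  define z where "z = (x + y) / 2"
  have z: "x < z" "z < y" using xy by (auto simp: z_def)
  have fy: "0 < f y" using xy by (simp add: gen_ext_def split: if_splits)
  have "f y < f z" using monotone_onD[OF f, of z y] neq[of z y] z xy fy by simp
  then have "gen_ext f y < gen_ext f z" using z xy fy by (simp add: gen_ext_def ennreal_lessI)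
  also have "\<dots> \<le> gen_ext f x" using z by (intro antimonoD[OF antimono_gen_ext[OF f]]) auto
  finally show "gen_ext f y < gen_ext f x" .
qed

text \<open>If \<open>f\<close> had equal values at two points, strict concavity would make it larger between them than at the left one.\<close>

lemma strictly_s_concave_generator_decreasing:
  assumes f: "antimono_on {0<..} f" and s: "strictly_s_concave_generator s f"
  shows "strictly_decreasing_on_support (gen_ext f)"
proof (rule strictly_decreasing_gen_ext[OF f])
  fix x y assume xy: "0 < x" "x < y" "0 < f y"
  show "f x \<noteq> f y"
  proof
    assume eq: "f x = f y"
    let ?z = "(1/2) *\<^sub>R x + (1 - 1/2) *\<^sub>R y"
    have "ennreal (f x) = power_mean s (1/2) (ennreal (f x)) (ennreal (f y))"
      by (simp add: eq power_mean_self)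
    also have "\<dots> < ennreal (f ?z)"
    proof -
      have "power_mean s \<theta> (ennreal (f x)) (ennreal (f y)) < ennreal (f (\<theta> *\<^sub>R x + (1 - \<theta>) *\<^sub>R y))"
        if "\<theta> \<in> {0<..<1}" for \<theta>
      proof -
        have "x \<in> gen_support f" "y \<in> gen_support f" "x \<noteq> y"
          using xy eq by (simp_all add: gen_support_def)
        then show ?thesis
          using s that unfolding strictly_s_concave_generator_def strictly_s_concave_on_def by blast
      qed
      from this[of "1/2"] show ?thesis by simp
    qed
    also have "\<dots> \<le> ennreal (f x)" using monotone_onD[OF f, of x ?z] xy by (intro ennreal_leI) auto
    finally show False by simp
  qed
qed

lemma radial_path:
  fixes e :: "'a::real_normed_vector"
  shows "((\<lambda>x. sqrt x *\<^sub>R e) \<longlongrightarrow> 0) (at_right 0)"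
proof -
  have "((\<lambda>x. sqrt x *\<^sub>R e) \<longlongrightarrow> sqrt 0 *\<^sub>R e) (at_right 0)"
    by (rule tendsto_scaleR[OF tendsto_real_sqrt[OF tendsto_ident_at] tendsto_const])
  then show ?thesis by simp
qed

text \<open>The point \<open>\<surd>x e\<close> has \<open>Q\<close>-value \<open>x\<close> and tends to the origin with \<open>x\<close>.\<close>

lemma elliptical_mode_bound:
  fixes Q :: "'a::real_normed_vector \<Rightarrow> real"
  assumes g: "\<And>y. g y = k * gen_ext f (Q y)" and k: "0 < k" "k < \<top>"
    and Q: "\<And>c y. Q (c *\<^sub>R y) = c\<^sup>2 * Q y" "Q e = 1"
    and mode: "0 \<in> modes g"
  shows "0 < gen_ext f 0" "\<forall>\<^sub>F x in at_right 0. gen_ext f x \<le> gen_ext f 0"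
proof -
  have Q0: "Q 0 = 0" using Q(1)[of 0 0] by simp
  show "0 < gen_ext f 0" using mode by (simp add: modes_def g Q0 ennreal_zero_less_mult_iff)
  have "\<forall>\<^sub>F y in nhds 0. g y \<le> g 0" using mode by (simp add: modes_def)
  then have "\<forall>\<^sub>F x in at_right 0. g (sqrt x *\<^sub>R e) \<le> g 0"
    by (rule eventually_compose_filterlim[OF _ radial_path])
  then show "\<forall>\<^sub>F x in at_right 0. gen_ext f x \<le> gen_ext f 0"
    using eventually_at_right_less[of 0]
    by eventually_elim (use k in \<open>simp add: g Q Q0 ennreal_mult_le_mult_iff\<close>)
qed

text \<open>A generator with a constant positive value on an interval makes every point of the corresponding open shell a mode,
  besides the origin.\<close>

lemma unimodal_elliptical_decreasing:
  fixes Q :: "'a::real_normed_vector \<Rightarrow> real"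
  assumes g: "\<And>y. g y = k * gen_ext f (Q y)" and k: "0 < k" "k < \<top>"
    and Q: "\<And>c y. Q (c *\<^sub>R y) = c\<^sup>2 * Q y" "Q e = 1" and cont: "continuous_on UNIV Q"
    and f: "antimono_on {0<..} f"
    and uni: "unimodal g" and mode: "0 \<in> modes g"
  shows "strictly_decreasing_on_support (gen_ext f)"
proof (rule strictly_decreasing_gen_ext[OF f])
  fix x y assume xy: "0 < x" "x < y" "0 < f y"
  show "f x \<noteq> f y"
  proof
    assume eq: "f x = f y"
    then have const: "f z = f y" if "x \<le> z" "z \<le> y" for z
      using monotone_onD[OF f, of x z] monotone_onD[OF f, of z y] that xy by auto
    define p where "p = sqrt ((x + y) / 2) *\<^sub>R e"
    have Qp: "Q p = (x + y) / 2" using xy by (simp add: p_def Q)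
    have "open (Q -` {x<..<y})" using cont by (intro open_vimage) auto
    moreover have "p \<in> Q -` {x<..<y}" using xy by (simp add: Qp)
    ultimately have "\<forall>\<^sub>F z in nhds p. z \<in> Q -` {x<..<y}" by (rule eventually_nhds_in_open)
    then have "\<forall>\<^sub>F z in nhds p. g z \<le> g p"
    proof eventually_elim
      case (elim z)
      then show ?case using xy const[of "Q z"] const[of "Q p"] by (simp add: g gen_ext_def Qp)
    qed
    then have "p \<in> modes g"
      using xy k const[of "(x + y) / 2"] by (simp add: modes_def g Qp gen_ext_def ennreal_zero_less_mult_iff)
    then have "p = 0" using uni mode by (auto simp: unimodal_def)
    then show False using Qp Q(1)[of 0 p] xy by simp
  qed
qed

lemma bdd_above_gen_ext_support:
  assumes "bounded (gen_support f)"
  shows "bdd_above {x. 0 < gen_ext f x}"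
proof -
  obtain R where R: "\<And>x. x \<in> gen_support f \<Longrightarrow> \<bar>x\<bar> \<le> R" using assms by (auto simp: bounded_real)
  show ?thesis
  proof (rule bdd_aboveI)
    fix x assume "x \<in> {x. 0 < gen_ext f x}"
    then show "x \<le> max R 0" using R[of x] by (cases "0 < x") (auto simp: gen_ext_def gen_support_def)
  qed
qed

section \<open>Lebesgue measure and marginal distributions\<close>

definition vtail :: "real^('n option) \<Rightarrow> real^'n" where
  "vtail y = (\<chi> j. y $ Some j)"

lemma vcons_nth [simp]: "vcons a v $ None = a" "vcons a v $ Some j = v $ j"
  by (simp_all add: vcons_def)

lemma vtail_vcons [simp]: "vtail (vcons a v) = v"
  by (simp add: vtail_def vec_eq_iff)

lemma vec_option_eq_iff: "x = y \<longleftrightarrow> x $ None = y $ None \<and> (\<forall>j. x $ Some j = y $ Some j)"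
  unfolding vec_eq_iff by (metis not_None_eq)

lemma linear_vcons: "linear (\<lambda>p. vcons (fst p) (snd p))"
  by (rule linearI) (simp_all add: vec_option_eq_iff)

lemma linear_vtail: "linear vtail"
  by (rule linearI) (simp_all add: vec_eq_iff vtail_def)

lemma borel_measurable_vcons [measurable]:
  "(\<lambda>p. vcons (fst p) (snd p)) \<in> borel_measurable (borel \<Otimes>\<^sub>M borel)"
  unfolding borel_prod
  by (intro borel_measurable_continuous_onI linear_continuous_on linear_conv_bounded_linear[THEN iffD1] linear_vcons)

lemma borel_measurable_vtail [measurable]: "vtail \<in> borel_measurable borel"
  by (intro borel_measurable_continuous_onI linear_continuous_on linear_conv_bounded_linear[THEN iffD1] linear_vtail)

lemma borel_measurable_vec_nth [measurable]: "(\<lambda>y::real^'m. y $ i) \<in> borel_measurable borel"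
  by (intro borel_measurable_continuous_onI continuous_intros)

lemma prod_Basis_vec:
  fixes a :: "real^'m"
  shows "(\<Prod>b\<in>Basis. a \<bullet> b) = (\<Prod>i\<in>UNIV. a $ i)"
proof -
  have B: "(Basis :: (real^'m) set) = (\<lambda>i. axis i 1) ` UNIV" by (auto simp: Basis_vec_def)
  have "inj (\<lambda>i::'m. axis i (1::real))" by (auto simp: inj_on_def axis_eq_axis)
  then show ?thesis unfolding B by (simp add: prod.reindex cart_eq_inner_axis)
qed

text \<open>Boxes split along the first coordinate, and they determine Lebesgue measure.\<close>

lemma lborel_vcons:
  "(lborel :: (real^('n::finite option)) measure) = distr (lborel \<Otimes>\<^sub>M lborel) borel (\<lambda>p. vcons (fst p) (snd p))"
proof (rule lborel_eqI)
  fix l u :: "real^('n option)"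
  assume le: "\<And>b. b \<in> Basis \<Longrightarrow> l \<bullet> b \<le> u \<bullet> b"
  have le': "l $ i \<le> u $ i" for i
    using le[of "axis i 1"] by (simp add: cart_eq_inner_axis)
  have le'': "vtail l \<bullet> b \<le> vtail u \<bullet> b" if "b \<in> Basis" for b
    using that le' by (auto simp: Basis_vec_def vtail_def inner_axis)
  have mem: "vcons a v \<in> box l u \<longleftrightarrow> a \<in> box (l $ None) (u $ None) \<and> v \<in> box (vtail l) (vtail u)" for a v
    by (auto simp: mem_box_cart vtail_def) (metis not_None_eq vcons_nth)+
  have "emeasure (distr (lborel \<Otimes>\<^sub>M lborel) borel (\<lambda>p. vcons (fst p) (snd p))) (box l u) =
      emeasure (lborel \<Otimes>\<^sub>M lborel) (box (l $ None) (u $ None) \<times> box (vtail l) (vtail u))"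
    by (subst emeasure_distr) (auto intro!: arg_cong2[where f = emeasure] simp: space_pair_measure mem)
  also have "\<dots> = emeasure lborel (box (l $ None) (u $ None)) * emeasure lborel (box (vtail l) (vtail u))"
    by (rule lborel.emeasure_pair_measure_Times) auto
  also have "\<dots> = ennreal (u $ None - l $ None) * ennreal (\<Prod>b\<in>Basis. (vtail u - vtail l) \<bullet> b)"
    using le' le'' by (simp add: emeasure_lborel_box)
  also have "\<dots> = ennreal ((u $ None - l $ None) * (\<Prod>b\<in>Basis. (vtail u - vtail l) \<bullet> b))"
    using le' by (simp add: ennreal_mult')
  also have "\<dots> = ennreal (\<Prod>b\<in>Basis. (u - l) \<bullet> b)"
    unfolding prod_Basis_vec UNIV_option_conv
    by (subst prod.insert) (auto simp: prod.reindex vtail_def)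
  finally show "emeasure (distr (lborel \<Otimes>\<^sub>M lborel) borel (\<lambda>p. vcons (fst p) (snd p))) (box l u) =
      ennreal (\<Prod>b\<in>Basis. (u - l) \<bullet> b)" .
qed simp

lemma nn_integral_vcons:
  fixes g :: "real^('n::finite option) \<Rightarrow> ennreal"
  assumes [measurable]: "g \<in> borel_measurable borel"
  shows "(\<integral>\<^sup>+y. g y \<partial>lborel) = (\<integral>\<^sup>+v. \<integral>\<^sup>+t. g (vcons t v) \<partial>lborel \<partial>lborel)"
proof -
  have [measurable]: "(\<lambda>p. g (vcons (fst p) (snd p))) \<in> borel_measurable (lborel \<Otimes>\<^sub>M lborel)"
    by measurable
  have "(\<integral>\<^sup>+y. g y \<partial>lborel) = (\<integral>\<^sup>+p. g (vcons (fst p) (snd p)) \<partial>(lborel \<Otimes>\<^sub>M lborel))"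
    by (subst lborel_vcons) (simp add: nn_integral_distr)
  also have "\<dots> = (\<integral>\<^sup>+v. \<integral>\<^sup>+t. g (vcons t v) \<partial>lborel \<partial>lborel)"
    using lborel_pair.nn_integral_snd[of "\<lambda>p. g (vcons (fst p) (snd p))"] by simp
  finally show ?thesis .
qed

lemma borel_measurable_slice:
  fixes g :: "real^('n::finite option) \<Rightarrow> ennreal"
  assumes [measurable]: "g \<in> borel_measurable borel"
  shows "(\<lambda>v. \<integral>\<^sup>+t. g (vcons t v) \<partial>lborel) \<in> borel_measurable borel"
proof -
  have "(\<lambda>p. g (vcons (fst p) (snd p))) \<in> borel_measurable (borel \<Otimes>\<^sub>M borel)" by measurable
  then have "(\<lambda>p. g (vcons (fst (snd p, fst p)) (snd (snd p, fst p)))) \<in> borel_measurable (borel \<Otimes>\<^sub>M lborel)"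
    by measurable
  then have "(\<lambda>(v, t). g (vcons t v)) \<in> borel_measurable (borel \<Otimes>\<^sub>M lborel)"
    by (simp add: case_prod_unfold)
  then show ?thesis by (rule lborel.borel_measurable_nn_integral)
qed

lemma emeasure_joint:
  fixes U\<^sub>0 :: "'a \<Rightarrow> real" and U\<^sub>1 :: "'a \<Rightarrow> real^'n"
  assumes D: "distributed M lborel (\<lambda>\<omega>. vcons (U\<^sub>0 \<omega>) (U\<^sub>1 \<omega>)) g"
    and [measurable]: "B \<in> sets borel" "A \<in> sets borel"
  shows "emeasure M {\<omega> \<in> space M. U\<^sub>0 \<omega> \<in> B \<and> U\<^sub>1 \<omega> \<in> A}
    = (\<integral>\<^sup>+v. (\<integral>\<^sup>+t\<in>B. g (vcons t v) \<partial>lborel) * indicator A v \<partial>lborel)"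
proof -
  have [measurable]: "g \<in> borel_measurable borel" using distributed_borel_measurable[OF D] by simp
  let ?S = "{y. y $ None \<in> B \<and> vtail y \<in> A}"
  have [measurable]: "?S \<in> sets borel" by measurable
  have "{\<omega> \<in> space M. U\<^sub>0 \<omega> \<in> B \<and> U\<^sub>1 \<omega> \<in> A} = (\<lambda>\<omega>. vcons (U\<^sub>0 \<omega>) (U\<^sub>1 \<omega>)) -` ?S \<inter> space M" by auto
  then have "emeasure M {\<omega> \<in> space M. U\<^sub>0 \<omega> \<in> B \<and> U\<^sub>1 \<omega> \<in> A} = (\<integral>\<^sup>+y. g y * indicator ?S y \<partial>lborel)"
    using distributed_emeasure[OF D, of ?S] by simp
  also have "\<dots> = (\<integral>\<^sup>+v. \<integral>\<^sup>+t. g (vcons t v) * indicator ?S (vcons t v) \<partial>lborel \<partial>lborel)"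
    by (rule nn_integral_vcons) measurable
  also have "\<dots> = (\<integral>\<^sup>+v. (\<integral>\<^sup>+t\<in>B. g (vcons t v) \<partial>lborel) * indicator A v \<partial>lborel)"
    by (intro nn_integral_cong) (simp add: indicator_def)
  finally show ?thesis .
qed

lemma distributed_components_measurable:
  assumes "distributed M lborel (\<lambda>\<omega>. vcons (U\<^sub>0 \<omega>) (U\<^sub>1 \<omega>)) g"
  shows "U\<^sub>0 \<in> borel_measurable M" "U\<^sub>1 \<in> borel_measurable M"
proof -
  have [measurable]: "(\<lambda>\<omega>. vcons (U\<^sub>0 \<omega>) (U\<^sub>1 \<omega>)) \<in> borel_measurable M"
    using distributed_measurable[OF assms] by simp
  have "(\<lambda>\<omega>. vcons (U\<^sub>0 \<omega>) (U\<^sub>1 \<omega>) $ None) \<in> borel_measurable M"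
    "(\<lambda>\<omega>. vtail (vcons (U\<^sub>0 \<omega>) (U\<^sub>1 \<omega>))) \<in> borel_measurable M" by measurable
  then show "U\<^sub>0 \<in> borel_measurable M" "U\<^sub>1 \<in> borel_measurable M" by simp_all
qed

lemma distributed_marginal_density:
  fixes U\<^sub>0 :: "'a \<Rightarrow> real" and U\<^sub>1 :: "'a \<Rightarrow> real^'n"
  assumes D: "distributed M lborel (\<lambda>\<omega>. vcons (U\<^sub>0 \<omega>) (U\<^sub>1 \<omega>)) g"
  shows "distributed M lborel U\<^sub>1 (marginal_density g)"
proof -
  note [measurable] = distributed_components_measurable[OF D]
  have [measurable]: "g \<in> borel_measurable borel" using distributed_borel_measurable[OF D] by simp
  have [measurable]: "marginal_density g \<in> borel_measurable borel"
    unfolding marginal_density_def by (rule borel_measurable_slice) measurable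
  have "distr M lborel U\<^sub>1 = density lborel (marginal_density g)"
  proof (rule measure_eqI)
    fix A assume "A \<in> sets (distr M lborel U\<^sub>1)"
    then have [measurable]: "A \<in> sets borel" by simp
    have "emeasure (distr M lborel U\<^sub>1) A = emeasure M {\<omega> \<in> space M. U\<^sub>0 \<omega> \<in> UNIV \<and> U\<^sub>1 \<omega> \<in> A}"
      by (subst emeasure_distr) (auto intro!: arg_cong[where f = "emeasure M"])
    also have "\<dots> = (\<integral>\<^sup>+v. marginal_density g v * indicator A v \<partial>lborel)"
      by (subst emeasure_joint[OF D]) (simp_all add: marginal_density_def)
    finally show "emeasure (distr M lborel U\<^sub>1) A = emeasure (density lborel (marginal_density g)) A"
      by (simp add: emeasure_density)
  qed simp
  then show ?thesis by (simp add: distributed_def)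
qed

lemma nn_integral_lborel_uminus:
  fixes h :: "'b::euclidean_space \<Rightarrow> ennreal"
  assumes [measurable]: "h \<in> borel_measurable borel"
  shows "(\<integral>\<^sup>+x. h (- x) \<partial>lborel) = (\<integral>\<^sup>+x. h x \<partial>lborel)"
proof -
  have "(lborel :: 'b measure) = distr lborel borel uminus"
    using lborel_affine[of "-1" "0::'b"] by (simp add: density_1)
  then have "(\<integral>\<^sup>+x. h x \<partial>lborel) = (\<integral>\<^sup>+x. h x \<partial>distr lborel borel uminus)" by metis
  then show ?thesis by (simp add: nn_integral_distr)
qed

text \<open>Central symmetry gives both open half-spaces the same probability, and the hyperplane between
  them is null.\<close>

lemma emeasure_positive_half:
  fixes U\<^sub>0 :: "'a \<Rightarrow> real" and U\<^sub>1 :: "'a \<Rightarrow> real^'n"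
  assumes M: "prob_space M"
    and D: "distributed M lborel (\<lambda>\<omega>. vcons (U\<^sub>0 \<omega>) (U\<^sub>1 \<omega>)) g" and even: "\<And>y. g (- y) = g y"
  shows "emeasure M {\<omega> \<in> space M. 0 < U\<^sub>0 \<omega>} = inverse 2"
proof -
  interpret prob_space M by fact
  note [measurable] = distributed_components_measurable[OF D]
  have [measurable]: "g \<in> borel_measurable borel" using distributed_borel_measurable[OF D] by simp
  define p where "p = emeasure M {\<omega> \<in> space M. 0 < U\<^sub>0 \<omega>}"
  have half: "emeasure M {\<omega> \<in> space M. U\<^sub>0 \<omega> \<in> B} = (\<integral>\<^sup>+y. g y * indicator B (y $ None) \<partial>lborel)"
    if [measurable]: "B \<in> sets borel" for B
  proof -
    have "{\<omega> \<in> space M. U\<^sub>0 \<omega> \<in> B} = (\<lambda>\<omega>. vcons (U\<^sub>0 \<omega>) (U\<^sub>1 \<omega>)) -` {y. y $ None \<in> B} \<inter> space M" by auto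
    moreover have "{y. y $ None \<in> B} \<in> sets (lborel :: (real^('n option)) measure)" by measurable
    ultimately show ?thesis
      using distributed_emeasure[OF D, of "{y. y $ None \<in> B}"] by (simp add: indicator_def)
  qed
  have "emeasure M {\<omega> \<in> space M. U\<^sub>0 \<omega> < 0} = (\<integral>\<^sup>+y. g y * indicator {..<0} (y $ None) \<partial>lborel)"
    using half[of "{..<0}"] by simp
  also have "\<dots> = (\<integral>\<^sup>+y. g (- y) * indicator {..<0} ((- y) $ None) \<partial>lborel)"
    by (rule nn_integral_lborel_uminus[symmetric]) measurable
  also have "\<dots> = (\<integral>\<^sup>+y. g y * indicator {0<..} (y $ None) \<partial>lborel)"
    by (intro nn_integral_cong) (simp add: even indicator_def)
  also have "\<dots> = p" using half[of "{0<..}"] by (simp add: p_def)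
  finally have neg: "emeasure M {\<omega> \<in> space M. U\<^sub>0 \<omega> < 0} = p" .
  have "emeasure M {\<omega> \<in> space M. U\<^sub>0 \<omega> \<in> {0} \<and> U\<^sub>1 \<omega> \<in> UNIV}
      = (\<integral>\<^sup>+v. (\<integral>\<^sup>+t\<in>{0}. g (vcons t v) \<partial>lborel) * indicator UNIV v \<partial>lborel)"
    by (rule emeasure_joint[OF D]) auto
  also have "\<dots> = 0"
  proof -
    have "(\<integral>\<^sup>+t\<in>{0}. g (vcons t v) \<partial>lborel) = 0" for v
    proof -
      have "AE t in lborel. t \<noteq> (0::real)" by (rule AE_lborel_singleton)
      then have "(\<integral>\<^sup>+t\<in>{0}. g (vcons t v) \<partial>lborel) = (\<integral>\<^sup>+t. 0 \<partial>(lborel::real measure))"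
        by (intro nn_integral_cong_AE) (auto elim!: eventually_mono)
      then show ?thesis by simp
    qed
    then show ?thesis by simp
  qed
  finally have zero: "emeasure M {\<omega> \<in> space M. U\<^sub>0 \<omega> = 0} = 0" by simp
  have "space M = {\<omega> \<in> space M. 0 < U\<^sub>0 \<omega>} \<union> ({\<omega> \<in> space M. U\<^sub>0 \<omega> < 0} \<union> {\<omega> \<in> space M. U\<^sub>0 \<omega> = 0})" by auto
  then have "1 = emeasure M ({\<omega> \<in> space M. 0 < U\<^sub>0 \<omega>} \<union> ({\<omega> \<in> space M. U\<^sub>0 \<omega> < 0} \<union> {\<omega> \<in> space M. U\<^sub>0 \<omega> = 0}))"
    using emeasure_space_1 by simp
  also have "\<dots> = p + (p + 0)"
    by (subst plus_emeasure[symmetric], measurable, force, subst plus_emeasure[symmetric], measurable, force)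
       (simp add: p_def[symmetric] neg zero)
  finally have "1 = 2 * p" by (simp add: mult_2)
  then have "inverse 2 = inverse 2 * 2 * p" by (simp add: mult.assoc)
  also have "inverse 2 * 2 = (1::ennreal)" by (metis ennreal_divide_self divide_ennreal_def mult.commute numeral_neq_zero ennreal_numeral_less_top order_less_irrefl zero_neq_numeral)
  finally show ?thesis by (simp add: p_def)
qed

lemma distributed_skew_density:
  fixes U\<^sub>0 :: "'a \<Rightarrow> real" and U\<^sub>1 :: "'a \<Rightarrow> real^'n"
  assumes M: "prob_space M"
    and D: "distributed M lborel (\<lambda>\<omega>. vcons (U\<^sub>0 \<omega>) (U\<^sub>1 \<omega>)) g" and even: "\<And>y. g (- y) = g y"
  shows "distributed (uniform_measure M {\<omega> \<in> space M. 0 < U\<^sub>0 \<omega>}) lborel U\<^sub>1 (skew_density g)"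
proof -
  note [measurable] = distributed_components_measurable[OF D]
  have [measurable]: "g \<in> borel_measurable borel" using distributed_borel_measurable[OF D] by simp
  let ?H = "{\<omega> \<in> space M. 0 < U\<^sub>0 \<omega>}"
  let ?N = "uniform_measure M ?H"
  have slice: "(\<lambda>v. \<integral>\<^sup>+t\<in>{0<..}. g (vcons t v) \<partial>lborel) \<in> borel_measurable borel"
    using borel_measurable_slice[of "\<lambda>y. g y * indicator {0<..} (y $ None)"] by simp
  then have [measurable]: "skew_density g \<in> borel_measurable borel"
    unfolding skew_density_def by measurable
  have "distr ?N lborel U\<^sub>1 = density lborel (skew_density g)"
  proof (rule measure_eqI)
    fix A assume "A \<in> sets (distr ?N lborel U\<^sub>1)"
    then have [measurable]: "A \<in> sets borel" by simp
    have "emeasure (distr ?N lborel U\<^sub>1) A = emeasure ?N (U\<^sub>1 -` A \<inter> space M)"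
      by (subst emeasure_distr) auto
    also have "\<dots> = emeasure M (?H \<inter> (U\<^sub>1 -` A \<inter> space M)) / emeasure M ?H"
      by (intro emeasure_uniform_measure) measurable
    also have "\<dots> = 2 * emeasure M {\<omega> \<in> space M. U\<^sub>0 \<omega> \<in> {0<..} \<and> U\<^sub>1 \<omega> \<in> A}"
    proof -
      have "?H \<inter> (U\<^sub>1 -` A \<inter> space M) = {\<omega> \<in> space M. U\<^sub>0 \<omega> \<in> {0<..} \<and> U\<^sub>1 \<omega> \<in> A}" by auto
      moreover have "inverse (inverse 2) = (2::ennreal)"
        using inverse_ennreal[of "1/2"] by simp
      ultimately show ?thesis
        unfolding emeasure_positive_half[OF M D even] by (simp add: divide_ennreal_def mult.commute)
    qed
    also have "\<dots> = 2 * (\<integral>\<^sup>+v. (\<integral>\<^sup>+t\<in>{0<..}. g (vcons t v) \<partial>lborel) * indicator A v \<partial>lborel)"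
      by (subst emeasure_joint[OF D]) simp_all
    also have "\<dots> = (\<integral>\<^sup>+v. skew_density g v * indicator A v \<partial>lborel)"
      using slice by (subst nn_integral_cmult[symmetric]) (auto simp: skew_density_def mult.assoc)
    finally show "emeasure (distr ?N lborel U\<^sub>1) A = emeasure (density lborel (skew_density g)) A"
      by (simp add: emeasure_density)
  qed simp
  then show ?thesis by (simp add: distributed_def)
qed

section \<open>Quadratic forms\<close>

text \<open>Substituting \<open>x = A w\<close> turns the form of the inverse at \<open>x\<close> into the form of \<open>A\<close> at \<open>w\<close>.\<close>

lemma positive_definite_matrix_inv:
  fixes A :: "real^'m^'m"
  assumes A: "positive_definite A"
  shows "positive_definite (matrix_inv A)"
proof -
  have sym: "transpose A = A" and pos: "\<And>x. x \<noteq> 0 \<Longrightarrow> 0 < x \<bullet> (A *v x)"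
    using A by (auto simp: positive_definite_def)
  have "x = 0" if "A *v x = 0" for x using pos[of x] that by force
  then obtain B where "B ** A = mat 1" using matrix_left_invertible_ker[of A] by blast
  then have "\<exists>B. A ** B = mat 1 \<and> B ** A = mat 1" using matrix_left_right_inverse[of A B] by blast
  then have inv: "A ** matrix_inv A = mat 1" "matrix_inv A ** A = mat 1"
    unfolding matrix_inv_def by (metis (mono_tags, lifting) someI_ex)+
  have "transpose (matrix_inv A) ** A = transpose (A ** matrix_inv A)"
    by (simp add: matrix_transpose_mul sym)
  then have "transpose (matrix_inv A) ** A = mat 1" by (simp add: inv transpose_mat)
  then have "transpose (matrix_inv A) = matrix_inv A"
    using inv(1) by (metis matrix_mul_assoc matrix_mul_lid matrix_mul_rid)
  moreover have "0 < x \<bullet> (matrix_inv A *v x)" if "x \<noteq> 0" for x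
  proof -
    let ?w = "matrix_inv A *v x"
    have w: "A *v ?w = x" by (simp add: matrix_vector_mul_assoc inv)
    then have "?w \<noteq> 0" using that by force
    from pos[OF this] show ?thesis by (simp add: w inner_commute)
  qed
  ultimately show ?thesis by (simp add: positive_definite_def)
qed

definition quad_form :: "real^'m^'m \<Rightarrow> real^'m \<Rightarrow> real" where
  "quad_form B y = y \<bullet> (B *v y)"

lemma quad_form_scaleR: "quad_form B (c *\<^sub>R y) = c\<^sup>2 * quad_form B y"
  by (simp add: quad_form_def matrix_vector_mult_scaleR power2_eq_square)

lemma quad_form_add:
  assumes "positive_definite B"
  shows "quad_form B (x + y) = quad_form B x + 2 * (x \<bullet> (B *v y)) + quad_form B y"
proof -
  have "y \<bullet> (B *v x) = x \<bullet> (B *v y)"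
    using assms by (metis positive_definite_def dot_lmul_matrix inner_commute vector_transpose_matrix)
  then show ?thesis
    by (simp add: quad_form_def matrix_vector_right_distrib inner_add_left inner_add_right)
qed

lemma quad_form_convex_combination:
  "quad_form B (\<theta> *\<^sub>R x + (1 - \<theta>) *\<^sub>R y)
    = \<theta> * quad_form B x + (1 - \<theta>) * quad_form B y - \<theta> * (1 - \<theta>) * quad_form B (x - y)"
  by (simp add: quad_form_def matrix_vector_right_distrib matrix_vector_mult_diff_distrib
      matrix_vector_mult_scaleR inner_add_left inner_add_right inner_diff_left inner_diff_right algebra_simps)

lemma quad_form_pos: "positive_definite B \<Longrightarrow> x \<noteq> 0 \<Longrightarrow> 0 < quad_form B x"
  by (simp add: quad_form_def positive_definite_def)

lemma quad_form_nonneg: "positive_definite B \<Longrightarrow> 0 \<le> quad_form B x"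
  using quad_form_pos[of B x] by (cases "x = 0") (auto simp: quad_form_def)

lemma continuous_quad_form: "continuous_on UNIV (quad_form B)"
proof -
  have "continuous_on UNIV ((*v) B)"
    by (intro linear_continuous_on linear_conv_bounded_linear[THEN iffD1] matrix_vector_mul_linear)
  then show ?thesis unfolding quad_form_def by (intro continuous_intros)
qed

lemma quad_form_strictly_convex:
  assumes "positive_definite B" "x \<noteq> y" "0 < \<theta>" "\<theta> < 1"
  shows "quad_form B (\<theta> *\<^sub>R x + (1 - \<theta>) *\<^sub>R y) < \<theta> * quad_form B x + (1 - \<theta>) * quad_form B y"
  using quad_form_pos[OF assms(1), of "x - y"] assms by (simp add: quad_form_convex_combination)

text \<open>\<open>\<alpha>\<close> is the value of the form at the first basis vector, and \<open>l v\<close> is the minimiser of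
  \<open>t \<mapsto> quad_form B (vcons t v)\<close>, linear in \<open>v\<close>.\<close>

lemma quad_form_complete_square:
  fixes B :: "real^('n::finite option)^('n option)"
  assumes B: "positive_definite B"
  obtains \<alpha> l where "0 < \<alpha>" "linear l" "quad_form B (vcons 1 0) = \<alpha>"
    "\<And>t v. quad_form B (vcons t v) = \<alpha> * (t - l v)\<^sup>2 + quad_form B (vcons (l v) v)"
proof
  let ?e = "vcons 1 0 :: real^('n option)"
  define \<alpha> where "\<alpha> = quad_form B ?e"
  define l where "l v = - (?e \<bullet> (B *v vcons 0 v)) / \<alpha>" for v
  have e: "?e \<noteq> 0" by (simp add: vec_option_eq_iff)
  then show \<alpha>: "0 < \<alpha>" unfolding \<alpha>_def by (rule quad_form_pos[OF B])
  show "quad_form B (vcons 1 0) = \<alpha>" by (simp add: \<alpha>_def)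
  have v0: "vcons 0 (x + y) = vcons 0 x + vcons 0 y" "vcons 0 (c *\<^sub>R x) = c *\<^sub>R vcons 0 x"
    for x y :: "real^'n" and c by (simp_all add: vec_option_eq_iff)
  show "linear l"
    by (rule linearI)
      (simp_all add: l_def v0 matrix_vector_right_distrib matrix_vector_mult_scaleR inner_add_right diff_divide_distrib)
  fix t v
  have expand: "quad_form B (vcons u v) = \<alpha> * u\<^sup>2 - 2 * \<alpha> * u * l v + quad_form B (vcons 0 v)" for u
  proof -
    have split: "vcons u v = u *\<^sub>R ?e + vcons 0 v" by (simp add: vec_option_eq_iff)
    have "quad_form B (vcons u v) = u\<^sup>2 * \<alpha> + 2 * (u * (?e \<bullet> (B *v vcons 0 v))) + quad_form B (vcons 0 v)"
      unfolding split quad_form_add[OF B] quad_form_scaleR \<alpha>_def by simp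
    moreover have "?e \<bullet> (B *v vcons 0 v) = - \<alpha> * l v" using \<alpha> by (simp add: l_def)
    ultimately show ?thesis by simp
  qed
  show "quad_form B (vcons t v) = \<alpha> * (t - l v)\<^sup>2 + quad_form B (vcons (l v) v)"
    unfolding expand[of t] expand[of "l v"] by (simp add: power2_eq_square algebra_simps)
qed

section \<open>Finiteness of slice integrals\<close>

lemma AE_open_exists:
  fixes S :: "'b::euclidean_space set"
  assumes "AE x in lborel. P x" "open S" "S \<noteq> {}"
  shows "\<exists>x\<in>S. P x"
proof (rule ccontr)
  assume "\<not> ?thesis"
  then have "AE x in lborel. x \<notin> S" using assms(1) by (auto elim!: eventually_mono)
  then have "S \<in> null_sets lborel" using assms(2) by (simp add: AE_iff_null_sets)
  then have "negligible S" by (simp add: negligible_iff_null_sets null_sets_completionI)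
  then show False using open_not_negligible assms by blast
qed

lemma slice_integral_translate:
  assumes "antimono G"
  shows "slice_integral G \<alpha> UNIV c r = slice_integral G \<alpha> UNIV 0 r"
proof -
  note [measurable] = borel_measurable_antimono_ennreal[OF assms]
  have "(\<integral>\<^sup>+t. G (\<alpha> * (t - c)\<^sup>2 + r) \<partial>lborel) = ennreal \<bar>1\<bar> * (\<integral>\<^sup>+t. G (\<alpha> * ((c + 1 * t) - c)\<^sup>2 + r) \<partial>lborel)"
    by (rule nn_integral_real_affine[of "\<lambda>t. G (\<alpha> * (t - c)\<^sup>2 + r)"]) simp_all
  then show ?thesis by (simp add: slice_integral_def)
qed

text \<open>The integral of a slice over the whole line does not depend on its centre and decreases with the offset. It is
  finite for almost every \<open>v\<close>, in particular for some \<open>v\<close> with offset below \<open>r\<close>.\<close>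

lemma slice_integral_finite:
  fixes l q :: "'b::euclidean_space \<Rightarrow> real"
  assumes G: "antimono G"
    and meas: "(\<lambda>v. slice_integral G \<alpha> UNIV (l v) (q v)) \<in> borel_measurable borel"
    and int: "(\<integral>\<^sup>+v. slice_integral G \<alpha> UNIV (l v) (q v) \<partial>lborel) < \<top>"
    and q: "continuous_on UNIV q" "q 0 = 0" and r: "0 < r"
  shows "slice_integral G \<alpha> J c r < \<top>"
proof -
  have "AE v in lborel. slice_integral G \<alpha> UNIV (l v) (q v) \<noteq> \<infinity>"
    using meas int by (intro nn_integral_PInf_AE) auto
  moreover have "open (q -` {..<r})" using q by (intro open_vimage) auto
  moreover have "q -` {..<r} \<noteq> {}" using q r by auto
  ultimately obtain v where v: "q v < r" "slice_integral G \<alpha> UNIV (l v) (q v) \<noteq> \<infinity>"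
    using AE_open_exists by blast
  have "slice_integral G \<alpha> J c r \<le> slice_integral G \<alpha> UNIV c r"
    unfolding slice_integral_def by (intro nn_integral_mono) (auto simp: indicator_def)
  also have "\<dots> = slice_integral G \<alpha> UNIV (l v) r"
    using slice_integral_translate[OF G] by metis
  also have "\<dots> \<le> slice_integral G \<alpha> UNIV (l v) (q v)"
    using v(1) by (intro slice_integral_antimono G) simp
  also have "\<dots> < \<top>" using v(2) by (simp add: less_top)
  finally show ?thesis .
qed

section \<open>Concavity of elliptical and skew-elliptical densities\<close>

text \<open>Division by 0 would leave only the values 0 and \<open>\<top>\<close>, and division by \<open>\<top>\<close> only the value 0; neither is possible for
  a function of integral 1.\<close>

lemma normalizing_integral_nontrivial:
  assumes D: "distributed M lborel X g" and M: "prob_space M" and g: "\<And>y. g y = h y / C"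
  shows "0 < C" "C < \<top>"
proof -
  interpret prob_space M by fact
  have [measurable]: "g \<in> borel_measurable lborel" by (rule distributed_borel_measurable[OF D])
  have "X -` UNIV \<inter> space M = space M" by auto
  then have one: "(\<integral>\<^sup>+y. g y \<partial>lborel) = 1"
    using distributed_emeasure[OF D, of UNIV] emeasure_space_1 by simp
  have "C \<noteq> 0"
  proof
    assume "C = 0"
    then have "g = (\<lambda>y. \<top> * g y)" by (auto simp: g ennreal_top_mult)
    then have "(\<integral>\<^sup>+y. g y \<partial>lborel) = \<top> * (\<integral>\<^sup>+y. g y \<partial>lborel)"
      by (metis nn_integral_cmult[OF \<open>g \<in> borel_measurable lborel\<close>])
    then show False by (simp add: one)
  qed
  then show "0 < C" by (simp add: zero_less_iff_neq_zero)
  have "C \<noteq> \<top>"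
  proof
    assume "C = \<top>"
    then have "g = (\<lambda>y. 0)" by (auto simp: g)
    then show False using one by simp
  qed
  then show "C < \<top>" by (simp add: less_top)
qed

theorem proposition13:
  fixes M :: "'a measure"
    and U\<^sub>0 :: "'a \<Rightarrow> real" and U\<^sub>1 :: "'a \<Rightarrow> real^'n"
    and \<Omega> :: "real^'n^'n" and \<delta> :: "real^'n"
    and f :: "real \<Rightarrow> real" and s :: real and s\<^sub>1 :: ereal
    and g\<^sub>U :: "real^('n option) \<Rightarrow> ennreal" and g\<^sub>1 g\<^sub>Z :: "real^'n \<Rightarrow> ennreal"
  defines "s\<^sub>1 \<equiv> (if s = -1 then -\<infinity> else ereal (s / (1 + s)))"
    and "g\<^sub>U \<equiv> elliptical_density (Omega_plus \<delta> \<Omega>) f"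
    and "g\<^sub>1 \<equiv> marginal_density g\<^sub>U"
    and "g\<^sub>Z \<equiv> skew_density g\<^sub>U"
  assumes "prob_space M"
    and "positive_definite (Omega_plus \<delta> \<Omega>)"
    and "\<And>i. Omega_plus \<delta> \<Omega> $ i $ i = 1"
    and "density_generator CARD('n option) f"
    and "distributed M lborel (\<lambda>\<omega>. vcons (U\<^sub>0 \<omega>) (U\<^sub>1 \<omega>)) g\<^sub>U"
    and "c_unimodal g\<^sub>U"
    and "-1 \<le> s"
    and "s_concave_generator (ereal s) f"
  shows "s_concave_density (ereal s) g\<^sub>U
    \<and> (distributed M lborel U\<^sub>1 g\<^sub>1 \<and> s_concave_density s\<^sub>1 g\<^sub>1)
    \<and> (distributed (uniform_measure M {\<omega> \<in> space M. 0 < U\<^sub>0 \<omega>}) lborel U\<^sub>1 g\<^sub>Z \<and> s_concave_density s\<^sub>1 g\<^sub>Z)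
    \<and> (unimodal g\<^sub>U \<or> strictly_s_concave_generator (ereal s) f \<longrightarrow>
         strictly_s_concave_density (ereal s) g\<^sub>U)
    \<and> (unimodal g\<^sub>U \<or> strictly_s_concave_generator (ereal s) f \<or> bounded (gen_support f) \<longrightarrow>
         strictly_s_concave_density s\<^sub>1 g\<^sub>1 \<and> strictly_s_concave_density s\<^sub>1 g\<^sub>Z)"
proof -
  note M = assms(5) and D = assms(9) and s = assms(11) and s_gen = assms(12)
  define B where "B = matrix_inv (Omega_plus \<delta> \<Omega>)"
  define Q where "Q = quad_form B"
  define G where "G = gen_ext f"
  define C where "C = (\<integral>\<^sup>+z. G (Q z) \<partial>lborel)"
  define k where "k = inverse C"
  have B: "positive_definite B" unfolding B_def by (rule positive_definite_matrix_inv) fact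
  have gC: "g\<^sub>U y = G (Q y) / C" for y
    by (simp add: g\<^sub>U_def elliptical_density_def C_def G_def Q_def quad_form_def B_def)
  have C: "0 < C" "C < \<top>" using normalizing_integral_nontrivial[OF D M gC] by auto
  have "k \<noteq> \<top>" "k \<noteq> 0" using C by (simp_all add: k_def)
  then have k: "0 < k" "k < \<top>" by (simp_all add: less_top zero_less_iff_neq_zero)
  have g: "g\<^sub>U y = k * G (Q y)" for y by (simp add: gC k_def divide_ennreal_def mult.commute)
  have Q_scale: "Q (c *\<^sub>R y) = c\<^sup>2 * Q y" for c y by (simp add: Q_def quad_form_scaleR)
  have Q0: "Q 0 = 0" using Q_scale[of 0 0] by simp
  have even: "g\<^sub>U (- y) = g\<^sub>U y" for y using Q_scale[of "-1" y] by (simp add: g)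
  obtain \<alpha> l where \<alpha>: "0 < \<alpha>" and l: "linear l" and Qe: "Q (vcons 1 0) = \<alpha>"
    and Q_square: "\<And>t v. Q (vcons t v) = \<alpha> * (t - l v)\<^sup>2 + Q (vcons (l v) v)"
    using quad_form_complete_square[OF B] unfolding Q_def by metis
  define q where "q v = Q (vcons (l v) v)" for v
  have Q_vcons: "Q (vcons t v) = \<alpha> * (t - l v)\<^sup>2 + q v" for t v
    unfolding q_def by (rule Q_square)
  \<comment> \<open>A vector with \<open>Q\<close>-value 1, along which the density runs through all values of the generator.\<close>
  have "Q ((1 / sqrt \<alpha>) *\<^sub>R vcons 1 0) = 1" using \<alpha> by (simp add: Q_scale Qe power_divide)
  note Q_radial = Q_scale this
  have mode: "0 \<in> modes g\<^sub>U" using zero_mode_if_even[OF assms(10) even] .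
  have fpos: "0 \<le> f x" if "0 < x" for x using assms(8) that by (simp add: density_generator_def)
  have f: "antimono_on {0<..} f"
    using elliptical_mode_bound[OF g[unfolded G_def] k Q_radial mode]
    by (intro generator_antimono[OF s_gen fpos]) auto
  have G: "antimono G" "s_concave_density (ereal s) G"
    unfolding G_def using antimono_gen_ext[OF f] s_concave_gen_ext[OF f s_gen] by auto

  have q0: "0 \<le> q v" for v by (simp add: q_def Q_def quad_form_nonneg[OF B])
  have vcons_comb: "vcons (l (\<theta> *\<^sub>R x + (1 - \<theta>) *\<^sub>R y)) (\<theta> *\<^sub>R x + (1 - \<theta>) *\<^sub>R y)
      = \<theta> *\<^sub>R vcons (l x) x + (1 - \<theta>) *\<^sub>R vcons (l y) y" for x y \<theta>
    by (simp add: vec_option_eq_iff linear_add[OF l] linear_scale[OF l])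
  have q_strict: "q (\<theta> *\<^sub>R x + (1 - \<theta>) *\<^sub>R y) < \<theta> * q x + (1 - \<theta>) * q y"
    if "x \<noteq> y" "0 < \<theta>" "\<theta> < 1" for x y \<theta>
  proof -
    have "vcons (l x) x \<noteq> vcons (l y) y" using that(1) by (metis vtail_vcons)
    then show ?thesis
      unfolding q_def vcons_comb Q_def using quad_form_strictly_convex[OF B] that by blast
  qed
  have q_convex: "q (\<theta> *\<^sub>R x + (1 - \<theta>) *\<^sub>R y) \<le> \<theta> * q x + (1 - \<theta>) * q y"
    if "0 < \<theta>" "\<theta> < 1" for x y \<theta>
    using q_strict[of x y \<theta>] that by (cases "x = y") (auto simp: algebra_simps)
  have Q_strict: "Q (\<theta> *\<^sub>R x + (1 - \<theta>) *\<^sub>R y) < \<theta> * Q x + (1 - \<theta>) * Q y"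
    if "x \<noteq> y" "0 < \<theta>" "\<theta> < 1" for x y \<theta>
    unfolding Q_def by (rule quad_form_strictly_convex[OF B that])
  have Q_convex: "Q (\<theta> *\<^sub>R x + (1 - \<theta>) *\<^sub>R y) \<le> \<theta> * Q x + (1 - \<theta>) * Q y"
    if "0 < \<theta>" "\<theta> < 1" for x y \<theta>
    using Q_strict[of x y \<theta>] that by (cases "x = y") (auto simp: algebra_simps)
  have cont_Q: "continuous_on UNIV Q" unfolding Q_def by (rule continuous_quad_form)
  have cont_q: "continuous_on UNIV q"
  proof -
    have "linear (\<lambda>v. vcons (l v) v)"
      by (rule linearI) (simp_all add: vec_option_eq_iff linear_add[OF l] linear_scale[OF l])
    then have "continuous_on UNIV (\<lambda>v. vcons (l v) v)"
      by (intro linear_continuous_on linear_conv_bounded_linear[THEN iffD1])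
    from continuous_on_compose2[OF cont_Q this] show ?thesis by (simp add: q_def)
  qed
  have "vcons 0 0 = (0 :: real^('n option))" by (simp add: vec_option_eq_iff)
  then have q_zero: "q 0 = 0" by (simp add: q_def linear_0[OF l] Q0)

  note [measurable] = borel_measurable_antimono_ennreal[OF G(1)]
  have slice: "(\<integral>\<^sup>+t\<in>J. g\<^sub>U (vcons t v) \<partial>lborel) = k * slice_integral G \<alpha> J (l v) (q v)"
    if [measurable]: "J \<in> sets borel" for J v
    unfolding slice_integral_def g Q_vcons mult.assoc
    by (rule nn_integral_cmult) measurable
  have g1: "g\<^sub>1 = (\<lambda>v. k * slice_integral G \<alpha> UNIV (l v) (q v))"
    using slice[of UNIV] by (simp add: g\<^sub>1_def marginal_density_def fun_eq_iff)
  have gZ: "g\<^sub>Z = (\<lambda>v. 2 * k * slice_integral G \<alpha> {0<..} (l v) (q v))"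
    using slice[of "{0<..}"] by (simp add: g\<^sub>Z_def skew_density_def fun_eq_iff mult.assoc)
  have k2: "0 < 2 * k" "2 * k < \<top>" using k by (simp_all add: ennreal_zero_less_mult_iff ennreal_mult_less_top)
  have s1: "s\<^sub>1 = marginal_order s" by (simp add: s\<^sub>1_def marginal_order_def)
  have D1: "distributed M lborel U\<^sub>1 g\<^sub>1" unfolding g\<^sub>1_def by (rule distributed_marginal_density[OF D])
  have DZ: "distributed (uniform_measure M {\<omega> \<in> space M. 0 < U\<^sub>0 \<omega>}) lborel U\<^sub>1 g\<^sub>Z"
    unfolding g\<^sub>Z_def by (rule distributed_skew_density[OF M D even])
  \<comment> \<open>The marginal density has integral 1, so almost all of its slices are finite.\<close>
  have fin: "slice_integral G \<alpha> J c r < \<top>" if "0 < r" for J c r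
  proof (rule slice_integral_finite[OF G(1) _ _ cont_q q_zero that])
    have inv_k: "inverse k * (k * x) = x" for x
      using k by (metis ennreal_inverse_mult' mult.assoc mult.commute mult_divide_eq_ennreal divide_ennreal_def less_imp_neq)
    have eq: "slice_integral G \<alpha> UNIV (l v) (q v) = inverse k * g\<^sub>1 v" for v by (simp add: g1 inv_k)
    have [measurable]: "g\<^sub>1 \<in> borel_measurable borel" using distributed_borel_measurable[OF D1] by simp
    show "(\<lambda>v. slice_integral G \<alpha> UNIV (l v) (q v)) \<in> borel_measurable borel"
      unfolding eq by measurable
    have "(\<integral>\<^sup>+v. g\<^sub>1 v \<partial>lborel) = emeasure M (U\<^sub>1 -` UNIV \<inter> space M)"
      using distributed_emeasure[OF D1, of UNIV] by simp
    also have "\<dots> = 1" using prob_space.emeasure_space_1[OF M] by (simp add: Int_absorb1)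
    finally have "(\<integral>\<^sup>+v. slice_integral G \<alpha> UNIV (l v) (q v) \<partial>lborel) = inverse k"
      unfolding eq by (simp add: nn_integral_cmult)
    then show "(\<integral>\<^sup>+v. slice_integral G \<alpha> UNIV (l v) (q v) \<partial>lborel) < \<top>"
      using k by (simp add: less_top[symmetric])
  qed

  have gU: "g\<^sub>U = (\<lambda>y. k * G (Q y))" by (rule ext) (rule g)
  have "s_concave_density (ereal s) g\<^sub>U"
    unfolding gU by (intro s_concave_density_cmult[OF k] s_concave_antimono_comp[OF G] Q_convex)
  moreover have "s_concave_density s\<^sub>1 g\<^sub>1" "s_concave_density s\<^sub>1 g\<^sub>Z"
    unfolding g1 gZ s1
    by (intro s_concave_density_cmult k k2 s_concave_slice_integral[OF G s \<alpha>] l q_convex; simp)+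
  moreover have dec: "strictly_decreasing_on_support G"
    if "unimodal g\<^sub>U \<or> strictly_s_concave_generator (ereal s) f"
    using that unimodal_elliptical_decreasing[OF g[unfolded G_def] k Q_radial cont_Q f _ mode]
      strictly_s_concave_generator_decreasing[OF f] unfolding G_def by blast
  moreover have "strictly_s_concave_density (ereal s) g\<^sub>U"
    if "unimodal g\<^sub>U \<or> strictly_s_concave_generator (ereal s) f"
  proof -
    have "0 \<le> Q x" for x by (simp add: Q_def quad_form_nonneg[OF B])
    then show ?thesis
      unfolding gU
      by (intro strictly_s_concave_density_cmult[OF k] strictly_s_concave_antimono_comp[OF G dec[OF that]] Q_strict)
  qed
  moreover have "strictly_s_concave_density s\<^sub>1 g\<^sub>1 \<and> strictly_s_concave_density s\<^sub>1 g\<^sub>Z"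
    if "unimodal g\<^sub>U \<or> strictly_s_concave_generator (ereal s) f \<or> bounded (gen_support f)"
  proof -
    have strict: "strictly_decreasing_on_support G \<or> bdd_above {x. 0 < G x}"
      using that dec bdd_above_gen_ext_support[of f] unfolding G_def by auto
    have K: "strictly_s_concave_density (marginal_order s) (\<lambda>v. slice_integral G \<alpha> J (l v) (q v))"
      if "convex J" "J \<in> sets borel" "\<And>t t'. t \<in> J \<Longrightarrow> t < t' \<Longrightarrow> t' \<in> J" for J
      by (rule strictly_s_concave_slice_integral[OF G s \<alpha> that l q_strict q0 fin strict])
    then show ?thesis
      unfolding g1 gZ s1 by (intro conjI strictly_s_concave_density_cmult k k2 K) auto
  qed
  ultimately show ?thesis using D1 DZ by blast
qed

end
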